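(* Let $n\ge 1$ and let $P,Q$ be non-zero polynomials in $n$ variables with coefficients in $\overline{K}_c$. Suppose that $$Q([i_1],\ldots,[i_n])\ne 0\quad\text{for all } i_1,\ldots,i_n\in\{0,1,2,\ldots\}\cup\{\infty\}.$$ Let $u_0(s_1,\ldots,s_n)=\sum_{i_1,\ldots,i_n\ge 0} c_{0,i_1,\ldots,i_n}\, s_1^{q^{i_1}}\cdots s_n^{q^{i_n}}$, with $c_{0,i_1,\ldots,i_n}\in\overline{K}_c$, be an $\mathbb F_q$-linear holomorphic function on a neighbourhood of the origin, i.e. the series converges on some neighbourhood of the origin. Then there exists a unique $u\in\mathcal F_{n+1}$ such that $$\left\{P(\Delta_1,\ldots,\Delta_n)+Q(\Delta_1,\ldots,\Delta_n)\,d\right\}u=0\qquad\text{and}\qquad \lim_{z\to 0} z^{-1}u(z,s_1,\ldots,s_n)=u_0(s_1,\ldots,s_n).$$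
   Context: Let $q=p^\upsilon$ with $p$ prime and $\upsilon\ge 1$. Let $K=\mathbb F_q((x))$ be the field of formal Laurent series over $\mathbb F_q$ with the absolute value $|t|=q^{-N}$ for $t=\sum_{j\ge N}\xi_jx^j$ with $\xi_N\ne 0$, and let $\overline{K}_c$ be the completion of an algebraic closure of $K$, with the extended absolute value. For $n\ge 0$ an integer put $[n]=x^{q^n}-x$ (so $[0]=0$), and put $[\infty]=-x$. Let $D_0=1$ and $D_m=[m][m-1]^q\cdots[1]^{q^{m-1}}$ for $m\ge1$. $\mathcal F_{n+1}$ denotes the set of germs at the origin of functions of $(z,s_1,\ldots,s_n)$ of the form $$u=\sum_{i_1=0}^\infty\cdots\sum_{i_n=0}^\infty\ \sum_{m=0}^{\min(i_1,\ldots,i_n)} c_{m,i_1,\ldots,i_n}\, s_1^{q^{i_1}}\cdots s_n^{q^{i_n}}\,\frac{z^{q^m}}{D_m},\qquad c_{m,i_1,\ldots,i_n}\in\overline{K}_c,$$ with the series convergent on some neighbourhood of the origin. Operators (each acting in one variable, the other variables being treated as scalars): $\tau u=u^q$; $\Delta_j u=u(\ldots,xs_j,\ldots)-x\,u(\ldots,s_j,\ldots)$ (the Carlitz difference operator in the variable $s_j$); $d=\tau^{-1}\Delta$ is the Carlitz derivative in $z$, i.e. $(du)(z)=\big(u(xz)-xu(z)\big)^{1/q}$, where $q$-th roots are unique in characteristic $p$. The operators $\Delta_j$ are $\overline{K}_c$-linear and commute with one another, so $P(\Delta_1,\ldots,\Delta_n)$ and $Q(\Delta_1,\ldots,\Delta_n)$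 are well defined. *)

theory Defs
  imports
    "HOL-Analysis.Analysis"
    "HOL-Algebra.Algebraic_Closure_Type"
    "HOL-Library.Poly_Mapping"
    "HOL-Library.Extended_Nat"
begin

text \<open>
  The absolute value of \<open>a\<close> is \<open>dist a 0\<close>. The library's classes of normed fields are real
  vector spaces and so exclude characteristic \<open>p\<close>.
\<close>

class complete_valued_field = Fields.field + complete_space +
  assumes dist_add_cancel: "dist (a + c) (b + c) = dist a b"
    and dist_mult_0: "dist (a * b) 0 = dist a 0 * dist b 0"
    and dist_ultrametric: "dist a c \<le> max (dist a b) (dist b c)"

instance complete_valued_field \<subseteq> topological_ab_group_add
proof
  fix a b :: 'a
  show "((\<lambda>w. fst w + snd w) \<longlongrightarrow> a + b) (nhds a \<times>\<^sub>F nhds b)"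
  proof (rule tendstoI)
    fix e :: real assume "e > 0"
    then have "\<forall>\<^sub>F w in nhds a \<times>\<^sub>F nhds b. dist (fst w) a < e \<and> dist (snd w) b < e"
      by (intro eventually_prodI[where P = "\<lambda>v. dist v a < e" and Q = "\<lambda>v. dist v b < e",
            THEN eventually_mono]) (auto simp: eventually_nhds_metric)
    then show "\<forall>\<^sub>F w in nhds a \<times>\<^sub>F nhds b. dist (fst w + snd w) (a + b) < e"
    proof (rule eventually_mono)
      fix w assume w: "dist (fst w) a < e \<and> dist (snd w) b < e"
      have "dist (fst w + snd w) (a + b)
          \<le> max (dist (fst w + snd w) (a + snd w)) (dist (a + snd w) (a + b))"
        by (rule dist_ultrametric)
      also have "dist (fst w + snd w) (a + snd w) = dist (fst w) a"
        by (rule dist_add_cancel)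
      also have "dist (a + snd w) (a + b) = dist (snd w) b"
        using dist_add_cancel[of "snd w" a b] by (simp add: add.commute)
      finally show "dist (fst w + snd w) (a + b) < e"
        using w by linarith
    qed
  qed
  have "dist (- v) (- a) = dist v a" for v
    using dist_add_cancel[of "- v" "v + a" "- a"] by (simp add: dist_commute)
  then show "(uminus \<longlongrightarrow> - a) (nhds a)"
    by (auto simp: tendsto_iff eventually_nhds_metric)
qed

text \<open>
  \<open>\<iota>\<close> exhibits \<open>'c\<close> as a completion of the algebraic closure of the field of Laurent series over
  the finite field \<open>'k\<close>, for an absolute value extending that of the Laurent series. (The metric
  that the library puts on Laurent series uses the base 2 instead of \<open>q\<close> and plays no role here.)
\<close>

locale completed_alg_closure =
  fixes \<iota> :: "'k::{field,finite} fls alg_closure \<Rightarrow> 'c::complete_valued_field"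
  assumes map_one: "\<iota> 1 = 1"
    and map_add: "\<iota> (a + b) = \<iota> a + \<iota> b"
    and map_mult: "\<iota> (a * b) = \<iota> a * \<iota> b"
    and abs_extends: "t \<noteq> 0 \<Longrightarrow> dist (\<iota> (to_ac t)) 0 = real CARD('k) powi (- fls_subdegree t)"
    and dense_range: "closure (range \<iota>) = UNIV"

definition bracket :: "nat \<Rightarrow> 'c::complete_valued_field \<Rightarrow> enat \<Rightarrow> 'c" where
  "bracket q x i = (case i of enat n \<Rightarrow> x ^ (q ^ n) - x | \<infinity> \<Rightarrow> - x)"

definition carlitz_D :: "nat \<Rightarrow> 'c::complete_valued_field \<Rightarrow> nat \<Rightarrow> 'c" where
  "carlitz_D q x m = (\<Prod>k<m. bracket q x (enat (m - k)) ^ (q ^ k))"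

text \<open>Polynomials in variables indexed by \<open>'n\<close>: finitely supported maps from exponents to coefficients.\<close>

type_synonym ('n, 'c) mpolynomial = "('n \<Rightarrow>\<^sub>0 nat) \<Rightarrow>\<^sub>0 'c"

definition mpoly_eval :: "('n::finite, 'c::comm_semiring_1) mpolynomial \<Rightarrow> ('n \<Rightarrow> 'c) \<Rightarrow> 'c" where
  "mpoly_eval P f = (\<Sum>m\<in>Poly_Mapping.keys P. Poly_Mapping.lookup P m * (\<Prod>j\<in>UNIV. f j ^ Poly_Mapping.lookup m j))"

text \<open>
  The value of a polynomial at commuting operators \<open>T j\<close>. A product of powers is a composition;
  the fold is independent of the order because the operators commute.
\<close>

definition monom_op ::
    "('n::finite \<Rightarrow> ('w \<Rightarrow> 'c) \<Rightarrow> 'w \<Rightarrow> 'c) \<Rightarrow> ('n \<Rightarrow>\<^sub>0 nat) \<Rightarrow> ('w \<Rightarrow> 'c) \<Rightarrow> 'w \<Rightarrow> 'c" where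
  "monom_op T m = Finite_Set.fold (\<lambda>j S. (T j ^^ Poly_Mapping.lookup m j) \<circ> S) id UNIV"

definition mpoly_op ::
    "('n::finite, 'c::comm_semiring_1) mpolynomial \<Rightarrow> ('n \<Rightarrow> ('w \<Rightarrow> 'c) \<Rightarrow> 'w \<Rightarrow> 'c) \<Rightarrow>
     ('w \<Rightarrow> 'c) \<Rightarrow> 'w \<Rightarrow> 'c" where
  "mpoly_op P T u = (\<lambda>w. \<Sum>m\<in>Poly_Mapping.keys P. Poly_Mapping.lookup P m * monom_op T m u w)"

text \<open>Functions of \<open>(z, s)\<close> with \<open>s = (s\<^sub>j)\<close> indexed by the finite type \<open>'n\<close>.\<close>

definition carlitz_Delta :: "'c::complete_valued_field \<Rightarrow> 'n::finite \<Rightarrow>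
    ('c \<times> ('c ^ 'n) \<Rightarrow> 'c) \<Rightarrow> 'c \<times> ('c ^ 'n) \<Rightarrow> 'c" where
  "carlitz_Delta x j u = (\<lambda>(z, s). u (z, \<chi> k. if k = j then x * s $ k else s $ k) - x * u (z, s))"

lemma carlitz_Delta_commute:
  "carlitz_Delta x j (carlitz_Delta x k u) = carlitz_Delta x k (carlitz_Delta x j u)"
proof (cases "j = k")
  case False
  have "(\<chi> l. if l = k then x * (\<chi> l. if l = j then x * s $ l else s $ l) $ l
            else (\<chi> l. if l = j then x * s $ l else s $ l) $ l)
      = (\<chi> l. if l = j then x * (\<chi> l. if l = k then x * s $ l else s $ l) $ l
            else (\<chi> l. if l = k then x * s $ l else s $ l) $ l)" for s
    using False by (simp add: vec_eq_iff)
  then show ?thesis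
    unfolding carlitz_Delta_def by (simp add: fun_eq_iff algebra_simps)
qed simp

text \<open>The \<open>q\<close>-th root exists and is unique, as \<open>'c\<close> is perfect of characteristic \<open>p\<close>.\<close>

definition carlitz_d :: "nat \<Rightarrow> 'c::complete_valued_field \<Rightarrow>
    ('c \<times> ('c ^ 'n::finite) \<Rightarrow> 'c) \<Rightarrow> 'c \<times> ('c ^ 'n) \<Rightarrow> 'c" where
  "carlitz_d q x u = (\<lambda>(z, s). THE y. y ^ q = u (x * z, s) - x * u (z, s))"

definition s_monom :: "nat \<Rightarrow> ('n::finite \<Rightarrow> nat) \<Rightarrow> 'c::complete_valued_field ^ 'n \<Rightarrow> 'c" where
  "s_monom q i s = (\<Prod>j\<in>UNIV. (s $ j) ^ (q ^ i j))"

definition germ :: "('w::{zero,topological_space} \<Rightarrow> 'c) \<Rightarrow> ('w \<Rightarrow> 'c) set" where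
  "germ u = {v. \<forall>\<^sub>F w in nhds 0. v w = u w}"

definition carlitz_F :: "nat \<Rightarrow> 'c::complete_valued_field \<Rightarrow> ('c \<times> ('c ^ 'n::finite) \<Rightarrow> 'c) set set" where
  "carlitz_F q x = germ ` {u. \<exists>c :: nat \<Rightarrow> ('n \<Rightarrow> nat) \<Rightarrow> 'c. \<forall>\<^sub>F (z, s) in nhds 0.
     ((\<lambda>(m, i). c m i * s_monom q i s * (z ^ (q ^ m) / carlitz_D q x m)) has_sum u (z, s))
       {(m, i). m \<le> Min (range i)}}"

end

theory Submission
  imports Defs
begin

text \<open>
  Since \<open>\<Delta>\<^sub>j\<close> multiplies \<open>s\<^sub>j ^ (q ^ i\<^sub>j)\<close> by \<open>[i\<^sub>j]\<close> and \<open>d\<close> sends \<open>z ^ (q ^ m) / D\<^sub>m\<close> to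
  \<open>z ^ (q ^ (m - 1)) / D\<^sub>m\<^sub>-\<^sub>1\<close> while taking \<open>q\<close>-th roots of the coefficients and of the powers of \<open>s\<close>, the
  equation is equivalent to the recursion \<open>c (m + 1) (i + 1) = (- P[i] / Q[i] * c m i) ^ q\<close>, which has a
  unique solution with prescribed \<open>c 0\<close>. The points \<open>[i]\<close>, with \<open>i\<close> in \<open>{0, 1, \<dots>, \<infinity>} ^ n\<close>, form a
  compact set, so the hypothesis on \<open>Q\<close> bounds \<open>P[i] / Q[i]\<close>; the coefficients then grow at most like
  \<open>C ^ (q ^ m) * T ^ (\<Sum>\<^sub>j q ^ i\<^sub>j)\<close>, and the series converges near the origin.
\<close>

text \<open>The constraint \<open>m \<le> Min (range i)\<close> lets the recursion reach every
  coefficient: \<open>(m, i)\<close> is obtained in \<open>m\<close> steps along the diagonal from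
  \<open>(0, i - m)\<close>. Unrolled, a bound \<open>A\<close> on the quotients enters as
  \<open>A ^ (q + ... + q ^ m)\<close>, and \<open>1 / D\<^sub>m\<close> has absolute value |x| to
  the power -(1 + q + ... + q^(m-1)). Both exponents are of order q^m because q is at least 2, so a
  smaller radius in \<open>z\<close> absorbs them. A bound
  \<open>T ^ (\<Sum>\<^sub>j q ^ i\<^sub>j)\<close> on the initial coefficients reproduces itself,
  since a q-th power multiplies the exponent by q just as the shift of \<open>i\<close> does; a
  smaller radius in \<open>s\<close> absorbs it. Passing between equation and recursion takes q-th
  roots in the completion, their continuity (to extract them term by term), and an identity theorem
  for series summable near 0.\<close>

no_notation fps_nth (infixl "$" 75)

section \<open>Complete valued fields\<close>

text \<open>Continuity of powers and of polynomials rests on this.\<close>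

instance complete_valued_field \<subseteq> topological_comm_monoid_mult
proof
  fix a b :: 'a
  have abs_diff: "dist v w = dist (v - w) 0" for v w :: 'a
    using dist_add_cancel[of v "- w" w] by simp
  show "((\<lambda>w. fst w * snd w) \<longlongrightarrow> a * b) (nhds a \<times>\<^sub>F nhds b)"
  proof (rule tendstoI)
    fix e :: real assume "e > 0"
    define M where "M = 1 + dist a 0 + dist b 0"
    have M: "M \<ge> 1" "dist a 0 \<le> M" "dist b 0 < M"
      using zero_le_dist[of a 0] zero_le_dist[of b 0] unfolding M_def by linarith+
    \<comment> \<open>The bound 1 keeps \<open>snd w\<close> in the ball of radius \<open>M\<close>;
      then \<open>d * M \<le> e\<close> serves both halves of the ultrametric estimate.\<close>
    define d where "d = min 1 (e / M)"
    have d: "d > 0" "d \<le> 1" "d * M \<le> e"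
      using \<open>e > 0\<close> M by (auto simp: d_def min_def field_simps)
    have "\<forall>\<^sub>F w in nhds a \<times>\<^sub>F nhds b. dist (fst w) a < d \<and> dist (snd w) b < d"
      using \<open>d > 0\<close>
      by (intro eventually_prodI[where P = "\<lambda>v. dist v a < d" and Q = "\<lambda>v. dist v b < d",
            THEN eventually_mono]) (auto simp: eventually_nhds_metric)
    then show "\<forall>\<^sub>F w in nhds a \<times>\<^sub>F nhds b. dist (fst w * snd w) (a * b) < e"
    proof (rule eventually_mono)
      fix w assume w: "dist (fst w) a < d \<and> dist (snd w) b < d"
      have b: "dist (snd w) 0 \<le> M"
        using dist_triangle[of "snd w" 0 b] w d zero_le_dist[of a 0] unfolding M_def by linarith
      have "dist (fst w * snd w) (a * b)
          \<le> max (dist (fst w * snd w) (a * snd w)) (dist (a * snd w) (a * b))"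
        by (rule dist_ultrametric)
      also have "dist (fst w * snd w) (a * snd w) = dist (fst w) a * dist (snd w) 0"
        using abs_diff[of "fst w * snd w" "a * snd w"] abs_diff[of "fst w" a]
        by (simp flip: left_diff_distrib dist_mult_0)
      also have "dist (a * snd w) (a * b) = dist a 0 * dist (snd w) b"
        using abs_diff[of "a * snd w" "a * b"] abs_diff[of "snd w" b]
        by (simp flip: right_diff_distrib dist_mult_0)
      also have "dist (fst w) a * dist (snd w) 0 \<le> dist (fst w) a * M"
        using b by (intro mult_left_mono) auto
      also have "dist a 0 * dist (snd w) b \<le> M * dist (snd w) b"
        using M by (intro mult_right_mono) auto
      also have "max (dist (fst w) a * M) (M * dist (snd w) b) < d * M"
        using w M by (simp add: mult.commute)
      finally show "dist (fst w * snd w) (a * b) < e" using d by linarith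
    qed
  qed
qed

definition vabs :: "'c::complete_valued_field \<Rightarrow> real" where
  "vabs a = dist a 0"

lemma dist_eq_vabs: "dist a b = vabs (a - b)"
  using dist_add_cancel[of a "- b" b] by (simp add: vabs_def)

lemma vabs_nonneg [simp]: "0 \<le> vabs a" and vabs_zero [simp]: "vabs 0 = 0"
  and vabs_eq_0_iff [simp]: "vabs a = 0 \<longleftrightarrow> a = 0"
  by (auto simp: vabs_def)

lemma vabs_pos_iff [simp]: "0 < vabs a \<longleftrightarrow> a \<noteq> 0"
  using vabs_nonneg[of a] by (auto simp: less_le)

lemma vabs_mult: "vabs (a * b) = vabs a * vabs b"
  by (simp add: vabs_def dist_mult_0)

lemma vabs_one [simp]: "vabs 1 = 1"
proof -
  have "vabs (1::'a) * vabs (1::'a) = vabs (1::'a) * 1"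
    unfolding vabs_mult[symmetric] by simp
  then show ?thesis by (metis mult_cancel_left vabs_eq_0_iff zero_neq_one)
qed

lemma vabs_power: "vabs (a ^ n) = vabs a ^ n"
  by (induction n) (auto simp: vabs_mult)

lemma vabs_prod: "vabs (\<Prod>k\<in>A. f k) = (\<Prod>k\<in>A. vabs (f k))"
  by (induction A rule: infinite_finite_induct) (auto simp: vabs_mult)

lemma vabs_divide: "vabs (a / b) = vabs a / vabs b"
proof (cases "b = 0")
  case False
  then have "vabs (a / b) * vabs b = vabs a" by (simp flip: vabs_mult)
  with False show ?thesis by (simp add: field_simps)
qed simp

lemma vabs_inverse: "vabs (inverse a) = inverse (vabs a)"
  by (simp add: inverse_eq_divide vabs_divide)

lemma vabs_minus [simp]: "vabs (- a) = vabs a"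
  using dist_eq_vabs[of 0 a] unfolding vabs_def by (metis diff_0 dist_commute)

lemma vabs_add_le: "vabs (a + b) \<le> max (vabs a) (vabs b)"
  using dist_ultrametric[of a "- b" 0] dist_eq_vabs[of a "- b"] dist_eq_vabs[of 0 "- b"]
  by (simp add: vabs_def dist_commute)

lemma vabs_diff_le: "vabs (a - b) \<le> max (vabs a) (vabs b)"
  using vabs_add_le[of a "- b"] by simp

lemma vabs_sum_le:
  assumes "\<And>k. k \<in> A \<Longrightarrow> vabs (f k) \<le> B" "0 \<le> B"
  shows "vabs (sum f A) \<le> B"
  using assms
proof (induction A rule: infinite_finite_induct)
  case (insert k A)
  then have "vabs (f k) \<le> B" "vabs (sum f A) \<le> B" by auto
  with insert.hyps show ?case using vabs_add_le[of "f k" "sum f A"] by simp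
qed auto

lemma tendsto_iff_vabs: "(f \<longlongrightarrow> l) F \<longleftrightarrow> ((\<lambda>w. vabs (f w - l)) \<longlongrightarrow> 0) F"
  unfolding dist_eq_vabs[symmetric] by (rule tendsto_dist_iff)

section \<open>Unordered sums in an ultrametric field\<close>

lemma vabs_has_sum_le:
  assumes "(f has_sum S) A" "\<And>k. k \<in> A \<Longrightarrow> vabs (f k) \<le> B" "0 \<le> B"
  shows "vabs S \<le> B"
proof -
  have "((\<lambda>F. dist (sum f F) 0) \<longlongrightarrow> dist S 0) (finite_subsets_at_top A)"
    using assms(1) by (intro tendsto_dist) (auto simp: has_sum_def)
  moreover have "\<forall>\<^sub>F F in finite_subsets_at_top A. dist (sum f F) 0 \<le> B"
    using assms(2,3) vabs_sum_le[of _ f B]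
    by (intro eventually_finite_subsets_at_top_weakI) (auto simp: vabs_def subset_iff)
  ultimately show ?thesis
    unfolding vabs_def by (rule tendsto_upperbound) simp
qed

text \<open>A finite sum is no larger than its largest term, so terms tending to 0 make the partial
  sums Cauchy. This takes the place of absolute convergence: it gives comparison tests and makes
  subfamilies summable.\<close>

lemma summable_on_iff_ultrametric:
  fixes f :: "'a \<Rightarrow> 'c::complete_valued_field"
  shows "f summable_on A \<longleftrightarrow> (\<forall>e>0. finite {k \<in> A. vabs (f k) \<ge> e})"
proof
  assume "f summable_on A"
  then obtain S where S: "(sum f \<longlongrightarrow> S) (finite_subsets_at_top A)"
    by (auto simp: summable_on_def has_sum_def)
  show "\<forall>e>0. finite {k \<in> A. vabs (f k) \<ge> e}"
  proof (intro allI impI)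
    fix e :: real assume "e > 0"
    from tendstoD[OF S this] obtain F where F: "finite F" "F \<subseteq> A"
      and near: "\<forall>G. finite G \<and> F \<subseteq> G \<and> G \<subseteq> A \<longrightarrow> dist (sum f G) S < e"
      unfolding eventually_finite_subsets_at_top by metis
    have "vabs (f k) < e" if "k \<in> A - F" for k
    proof -
      have "f k = (sum f (insert k F) - S) - (sum f F - S)"
        using that F by simp
      moreover have "vabs (sum f (insert k F) - S) < e" "vabs (sum f F - S) < e"
        using near[rule_format, of F] near[rule_format, of "insert k F"] that F by (auto simp flip: dist_eq_vabs)
      ultimately show ?thesis
        using vabs_diff_le[of "sum f (insert k F) - S" "sum f F - S"] by simp
    qed
    then have "{k \<in> A. vabs (f k) \<ge> e} \<subseteq> F" by force
    with F show "finite {k \<in> A. vabs (f k) \<ge> e}" by (blast intro: finite_subset)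
  qed
next
  assume small: "\<forall>e>0. finite {k \<in> A. vabs (f k) \<ge> e}"
  have "\<exists>P. eventually P (finite_subsets_at_top A) \<and>
      (\<forall>F G. P F \<and> P G \<longrightarrow> dist (sum f F) (sum f G) < e)" if "e > 0" for e
  proof (intro exI conjI allI impI)
    \<comment> \<open>Combining two ultrametric estimates costs no factor; halving only turns the
      non-strict tail bound into a strict one.\<close>
    define F where "F = {k \<in> A. vabs (f k) \<ge> e / 2}"
    let ?P = "\<lambda>G. finite G \<and> F \<subseteq> G \<and> G \<subseteq> A"
    have "finite F" unfolding F_def using small half_gt_zero[OF that] by blast
    then show "eventually ?P (finite_subsets_at_top A)"
      by (auto simp: eventually_finite_subsets_at_top F_def)
    have near: "vabs (sum f G - sum f F) \<le> e / 2" if "?P G" for G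
    proof -
      have "sum f G - sum f F = sum f (G - F)"
        using that by (simp add: sum_diff)
      also have "vabs \<dots> \<le> e / 2"
        using that \<open>e > 0\<close> by (intro vabs_sum_le) (auto simp: F_def)
      finally show ?thesis .
    qed
    fix G H assume "?P G \<and> ?P H"
    then have "vabs (sum f G - sum f F) \<le> e / 2" "vabs (sum f H - sum f F) \<le> e / 2"
      using near by blast+
    moreover have "sum f G - sum f H = (sum f G - sum f F) - (sum f H - sum f F)" by simp
    ultimately have "vabs (sum f G - sum f H) \<le> e / 2"
      using vabs_diff_le[of "sum f G - sum f F" "sum f H - sum f F"] by simp
    then show "dist (sum f G) (sum f H) < e" using that by (simp add: dist_eq_vabs)
  qed
  then have "cauchy_filter (filtermap (sum f) (finite_subsets_at_top A))"
    by (simp add: cauchy_filter_metric_filtermap)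
  moreover have "complete (UNIV :: 'c set)"
    by (meson Cauchy_convergent UNIV_I complete_def convergent_def)
  ultimately obtain S where "(sum f \<longlongrightarrow> S) (finite_subsets_at_top A)"
    using complete_uniform[where S = "UNIV :: 'c set"] by (force simp: filterlim_def)
  then show "f summable_on A"
    by (auto simp: summable_on_def has_sum_def)
qed

text \<open>The source of the Cauchy estimates: summability at one point with nonzero coordinates
  bounds all coefficients geometrically.\<close>

lemma summable_on_imp_vabs_bounded:
  fixes f :: "'a \<Rightarrow> 'c::complete_valued_field"
  assumes "f summable_on A"
  obtains B where "B \<ge> 1" "\<And>k. k \<in> A \<Longrightarrow> vabs (f k) \<le> B"
proof -
  define F where "F = {k \<in> A. vabs (f k) \<ge> 1}"
  have "finite F" using assms by (auto simp: F_def summable_on_iff_ultrametric)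
  define B where "B = Max (insert 1 ((\<lambda>k. vabs (f k)) ` F))"
  have "vabs (f k) \<le> B" if "k \<in> A" for k
  proof (cases "k \<in> F")
    case True
    with \<open>finite F\<close> show ?thesis by (simp add: B_def)
  next
    case False
    with that have "vabs (f k) \<le> 1" by (auto simp: F_def)
    also have "1 \<le> B" using \<open>finite F\<close> by (simp add: B_def)
    finally show ?thesis .
  qed
  moreover have "B \<ge> 1" using \<open>finite F\<close> by (simp add: B_def)
  ultimately show ?thesis using that by blast
qed

section \<open>Compactness and continuity of polynomials\<close>

lemma compact_insert_limit:
  fixes f :: "nat \<Rightarrow> 'a::topological_space"
  assumes "f \<longlonglongrightarrow> l"
  shows "compact (insert l (range f))"
proof (rule compactI)
  fix C assume C: "\<forall>T\<in>C. open T" "insert l (range f) \<subseteq> \<Union>C"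
  then obtain T where T: "T \<in> C" "l \<in> T" by auto
  with assms C obtain N where N: "\<And>n. n \<ge> N \<Longrightarrow> f n \<in> T"
    using topological_tendstoD[OF assms, of T] by (auto simp: eventually_sequentially)
  have "\<forall>n. \<exists>V\<in>C. f n \<in> V" using C by blast
  then obtain V where V: "\<And>n. V n \<in> C" "\<And>n. f n \<in> V n" by metis
  have "f n \<in> \<Union>(insert T (V ` {..<N}))" for n
    using V N[of n] by (cases "n < N") auto
  with T V show "\<exists>C'\<subseteq>C. finite C' \<and> insert l (range f) \<subseteq> \<Union>C'"
    by (intro exI[of _ "insert T (V ` {..<N})"]) auto
qed

lemma compact_Pi_UNIV:
  fixes S :: "'a \<Rightarrow> 'b::topological_space set"
  assumes "\<And>i. compact (S i)"
  shows "compact {f. \<forall>i. f i \<in> S i}"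
proof -
  have "compactin (product_topology (\<lambda>_. euclidean) UNIV) (PiE UNIV S)"
    using assms by (auto simp: compactin_PiE)
  moreover have "PiE UNIV S = {f. \<forall>i. f i \<in> S i}" by auto
  ultimately show ?thesis by (simp add: euclidean_product_topology)
qed

lemma mpoly_eval_continuous:
  fixes Q :: "('n::finite, 'c::complete_valued_field) mpolynomial"
  shows "continuous_on A (mpoly_eval Q)"
proof -
  have coord: "continuous_on A (\<lambda>f. f j)" for j
    by (rule continuous_on_subset[OF continuous_on_product_coordinates]) simp
  have "continuous_on A (\<lambda>f. f j ^ k)" for j k
    using continuous_on_power'[OF coord[of j] continuous_on_const[of A k]] by simp
  then show ?thesis
    unfolding mpoly_eval_def[abs_def]
    by (intro continuous_on_sum continuous_on_mult' continuous_on_const continuous_on_prod')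
qed

section \<open>Perfectness of the completion and the Carlitz factorials\<close>

text \<open>Series converge on polydiscs, while the metric on vectors is the Euclidean combination
  of the coordinate distances; near 0 the two give the same neighbourhoods.\<close>

lemma eventually_nhds_zero_vec:
  "(\<forall>\<^sub>F s in nhds (0 :: 'c::complete_valued_field ^ 'n::finite). P s) \<longleftrightarrow>
     (\<exists>r>0. \<forall>s. (\<forall>j. vabs (s $ j) < r) \<longrightarrow> P s)"
proof
  assume "\<forall>\<^sub>F s in nhds (0 :: 'c ^ 'n). P s"
  then obtain d where d: "d > 0" "\<And>s. dist s 0 < d \<Longrightarrow> P s"
    by (auto simp: eventually_nhds_metric)
  \<comment> \<open>The Euclidean distance is at most the sum of the coordinate distances, hence the
    division by their number.\<close>
  have "P s" if s: "\<And>j. vabs (s $ j) < d / CARD('n)" for s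
  proof (rule d)
    have "dist s 0 \<le> (\<Sum>j\<in>UNIV. vabs (s $ j))"
      by (simp add: dist_vec_def vabs_def L2_set_le_sum)
    also have "\<dots> < (\<Sum>j\<in>(UNIV :: 'n set). d / CARD('n))"
      using s by (intro sum_strict_mono) auto
    finally show "dist s 0 < d" by simp
  qed
  then show "\<exists>r>0. \<forall>s. (\<forall>j. vabs (s $ j) < r) \<longrightarrow> P s"
    using d(1) by (intro exI[of _ "d / CARD('n)"]) auto
next
  assume "\<exists>r>0. \<forall>s. (\<forall>j. vabs (s $ j) < r) \<longrightarrow> P s"
  then obtain r where r: "r > 0" "\<And>s. (\<And>j. vabs (s $ j) < r) \<Longrightarrow> P s" by auto
  have "P s" if "dist s 0 < r" for s
  proof (rule r)
    fix j
    have "vabs (s $ j) \<le> dist s 0"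
      using dist_vec_nth_le[of s j 0] by (simp add: vabs_def)
    with that show "vabs (s $ j) < r" by simp
  qed
  with r(1) show "\<forall>\<^sub>F s in nhds (0 :: 'c ^ 'n). P s"
    by (auto simp: eventually_nhds_metric)
qed

lemma eventually_nhds_zero_pair:
  "(\<forall>\<^sub>F w in nhds (0 :: 'c::complete_valued_field \<times> ('c ^ 'n::finite)). P w) \<longleftrightarrow>
     (\<exists>r>0. \<forall>z s. vabs z < r \<and> (\<forall>j. vabs (s $ j) < r) \<longrightarrow> P (z, s))"
proof
  assume "\<forall>\<^sub>F w in nhds (0 :: 'c \<times> ('c ^ 'n)). P w"
  then have "eventually P (nhds (0::'c) \<times>\<^sub>F nhds (0 :: 'c ^ 'n))"
    by (simp add: zero_prod_def nhds_prod)
  then obtain A B where AB: "eventually A (nhds (0::'c))" "eventually B (nhds (0 :: 'c ^ 'n))"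
    "\<And>z s. A z \<Longrightarrow> B s \<Longrightarrow> P (z, s)"
    by (auto simp: eventually_prod_filter)
  obtain r1 where r1: "r1 > 0" "\<And>z. vabs z < r1 \<Longrightarrow> A z"
    using AB(1) by (auto simp: eventually_nhds_metric vabs_def)
  obtain r2 where r2: "r2 > 0" "\<And>s. (\<And>j. vabs (s $ j) < r2) \<Longrightarrow> B s"
    using AB(2) by (auto simp: eventually_nhds_zero_vec)
  have "P (z, s)" if "vabs z < min r1 r2 \<and> (\<forall>j. vabs (s $ j) < min r1 r2)" for z s
    using that r1 r2 by (intro AB(3)) auto
  with r1(1) r2(1) show "\<exists>r>0. \<forall>z s. vabs z < r \<and> (\<forall>j. vabs (s $ j) < r) \<longrightarrow> P (z, s)"
    by (intro exI[of _ "min r1 r2"]) auto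
next
  assume "\<exists>r>0. \<forall>z s. vabs z < r \<and> (\<forall>j. vabs (s $ j) < r) \<longrightarrow> P (z, s)"
  then obtain r where r: "r > 0" "\<And>z s. vabs z < r \<Longrightarrow> \<forall>j. vabs (s $ j) < r \<Longrightarrow> P (z, s)"
    by blast
  have "\<forall>\<^sub>F z in nhds (0::'c). vabs z < r"
    using r(1) by (auto simp: eventually_nhds_metric vabs_def)
  moreover have "\<forall>\<^sub>F s in nhds (0 :: 'c ^ 'n). \<forall>j. vabs (s $ j) < r"
    using r(1) by (auto simp: eventually_nhds_zero_vec)
  ultimately have "eventually P (nhds (0::'c) \<times>\<^sub>F nhds (0 :: 'c ^ 'n))"
    using r(2) unfolding eventually_prod_filter
    by (intro exI[of _ "\<lambda>z. vabs z < r"] exI[of _ "\<lambda>s. \<forall>j. vabs (s $ j) < r"]) auto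
  then show "\<forall>\<^sub>F w in nhds (0 :: 'c \<times> ('c ^ 'n)). P w"
    by (simp add: zero_prod_def nhds_prod)
qed

text \<open>Multiplication by a nonzero \<open>a\<close> permutes the nonzero elements; comparing
  their products gives \<open>a ^ (CARD('k) - 1) = 1\<close>.\<close>

lemma finite_field_power_CARD: "(a :: 'k::{field,finite}) ^ CARD('k) = a"
proof (cases "a = 0")
  case False
  have "(\<Prod>b\<in>UNIV - {0}. a * b) = \<Prod>(UNIV - {0})"
    by (rule prod.reindex_bij_witness[of _ "\<lambda>b. b / a" "\<lambda>b. a * b"]) (use False in auto)
  then have "a ^ (CARD('k) - 1) = 1"
    by (simp add: prod.distrib card_Diff_singleton)
  then show ?thesis
    using power_minus_mult[of "CARD('k)" a] by simp
qed simp

text \<open>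
  The polynomial \<open>(X + 1) ^ q - X ^ q - 1\<close> has degree less than \<open>q\<close> and vanishes at the \<open>q\<close> points of the
  field, so its coefficients are zero.
\<close>
lemma of_nat_CARD_choose_eq_0:
  assumes "0 < k" "k < CARD('k)"
  shows "of_nat (CARD('k) choose k) = (0 :: 'k::{field,finite})"
proof -
  define q where "q = CARD('k)"
  define p :: "'k poly" where "p = (\<Sum>k = 1..<q. Polynomial.monom (of_nat (q choose k)) k)"
  have coeff_p: "Polynomial.coeff p k = (if 1 \<le> k \<and> k < q then of_nat (q choose k) else 0)" for k
    by (simp add: p_def coeff_sum if_distrib cong: if_cong)
  have q: "q > 0" by (simp add: q_def)
  have "poly p a = 0" for a
  proof -
    have "{..q} = insert 0 (insert q {1..<q})" using q by auto
    then have "(a + 1) ^ q = a ^ q + 1 + poly p a"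
      using q by (simp add: binomial_ring p_def poly_sum poly_monom)
    then show ?thesis
      using finite_field_power_CARD[of a] finite_field_power_CARD[of "a + 1"] by (simp add: q_def)
  qed
  then have roots: "{a. poly p a = 0} = UNIV" by auto
  have "p = 0"
  proof (rule ccontr)
    assume "p \<noteq> 0"
    then have "q \<le> Polynomial.degree p" using card_poly_roots_bound[of p] by (simp add: roots q_def)
    with \<open>p \<noteq> 0\<close> coeff_p[of "Polynomial.degree p"] show False by (simp add: leading_coeff_0_iff)
  qed
  with coeff_p[of k] assms show ?thesis by (simp add: q_def)
qed

lemma (in completed_alg_closure) map_zero: "\<iota> 0 = 0"
proof -
  have "\<iota> 0 + 0 = \<iota> 0 + \<iota> 0" unfolding map_add[symmetric] by (simp only: add_0_right)
  then show ?thesis by (simp only: add_left_cancel)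
qed

lemma (in completed_alg_closure) map_of_nat: "\<iota> (of_nat n) = of_nat n"
  by (induction n) (simp_all add: map_zero map_one map_add)

lemma (in completed_alg_closure) map_power: "\<iota> (a ^ n) = \<iota> a ^ n"
  by (induction n) (simp_all add: map_one map_mult)

text \<open>Collects what the analysis takes from Laurent series and the algebraic closure: the
  q-power map is additive and onto, and \<open>x\<close> has absolute value 1/q.\<close>

locale carlitz_setting =
  fixes q :: nat and x :: "'c::complete_valued_field"
  assumes q_ge_2: "q \<ge> 2"
    and frobenius_add: "((a :: 'c) + b) ^ q = a ^ q + b ^ q"
    and root_exists: "\<exists>y. y ^ q = (a :: 'c)"
    and vabs_x: "vabs x = 1 / q"

text \<open>Roots exist in the algebraic closure and must be carried to the completion. Additivity
  of the q-power map gives |y - z|^q = |y^q - z^q|, so roots of a sequence tending to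
  \<open>a\<close> form a Cauchy sequence, whose limit is a root of \<open>a\<close>.\<close>

lemma (in completed_alg_closure) carlitz_setting:
  "carlitz_setting CARD('k) (\<iota> (to_ac fls_X))"
proof
  let ?q = "CARD('k)"
  have "card {0, 1 :: 'k} \<le> ?q" by (intro card_mono) auto
  then show q2: "?q \<ge> 2" by simp
  show frobenius_add: "(a + b) ^ ?q = a ^ ?q + b ^ ?q" for a b :: 'c
  proof -
    have choose_0: "of_nat (?q choose k) = (0::'c)" if "k \<in> {1..<?q}" for k
    proof -
      \<comment> \<open>The binomial coefficient already vanishes in \<open>'k\<close>; the
        embedding of constants carries this to \<open>'c\<close>.\<close>
      have "of_nat (?q choose k) = \<iota> (to_ac (fls_const (of_nat (?q choose k))))"
        by (simp add: map_of_nat flip: fls_of_nat)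
      also have "\<dots> = 0" using that of_nat_CARD_choose_eq_0[where 'k = 'k, of k] map_zero by simp
      finally show ?thesis .
    qed
    have "{..?q} = insert 0 (insert ?q {1..<?q})" using q2 by auto
    then show ?thesis
      using q2 choose_0 by (simp add: binomial_ring add.commute)
  qed
  have frobenius_diff: "(a - b) ^ ?q = a ^ ?q - b ^ ?q" for a b :: 'c
    using frobenius_add[of "a - b" b] by simp
  show "\<exists>y. y ^ ?q = a" for a :: 'c
  proof -
    have "a \<in> closure (range \<iota>)" by (simp add: dense_range)
    then obtain f where f: "\<And>n. f n \<in> range \<iota>" "f \<longlonglongrightarrow> a"
      by (auto simp: closure_sequential)
    have "\<exists>y. y ^ ?q = f n" for n
    proof -
      obtain t where "f n = \<iota> t" using f(1)[of n] by auto
      moreover obtain y where "y ^ ?q = t" using nth_root_exists[of ?q t] q2 by auto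
      ultimately show ?thesis by (metis map_power)
    qed
    then obtain g where g: "\<And>n. g n ^ ?q = f n" by metis
    have "Cauchy g"
      unfolding Cauchy_altdef2
    proof (intro allI impI)
      fix e :: real assume "e > 0"
      have "Cauchy f" using f(2) by (rule LIMSEQ_imp_Cauchy)
      then obtain N where N: "\<And>n. n \<ge> N \<Longrightarrow> dist (f n) (f N) < e ^ ?q"
        using zero_less_power[OF \<open>e > 0\<close>] unfolding Cauchy_altdef2 by metis
      have "dist (g n) (g N) < e" if "n \<ge> N" for n
      proof -
        have "dist (g n) (g N) ^ ?q = dist (f n) (f N)"
          by (simp add: dist_eq_vabs g frobenius_diff flip: vabs_power)
        with N[OF that] have "dist (g n) (g N) ^ ?q < e ^ ?q" by simp
        then show ?thesis using \<open>e > 0\<close> by (rule power_less_imp_less_base[OF _ less_imp_le])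
      qed
      then show "\<exists>N. \<forall>n\<ge>N. dist (g n) (g N) < e" by blast
    qed
    then obtain y where "g \<longlonglongrightarrow> y" using Cauchy_convergent convergentD by blast
    then have "(\<lambda>n. g n ^ ?q) \<longlonglongrightarrow> y ^ ?q" by (intro tendsto_power_strong tendsto_const)
    with f(2) show ?thesis using LIMSEQ_unique by (auto simp: g)
  qed
  show "vabs (\<iota> (to_ac fls_X)) = 1 / ?q"
    by (simp add: vabs_def abs_extends power_int_minus field_simps)
qed

context carlitz_setting
begin

lemma q_pos [simp]: "q > 0" using q_ge_2 by simp

lemma frobenius_diff: "(a - b :: 'c) ^ q = a ^ q - b ^ q"
  using frobenius_add[of "a - b" b] by simp

text \<open>The same description as in \<open>carlitz_d\<close>, so that unfolding identifies the
  two.\<close>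

definition qroot :: "'c \<Rightarrow> 'c" where
  "qroot a = (THE y. y ^ q = a)"

lemma power_q_inject: "(y :: 'c) ^ q = z ^ q \<longleftrightarrow> y = z"
  using frobenius_diff[of y z] by auto

lemma qroot_power: "qroot a ^ q = a"
proof -
  obtain y where "y ^ q = a" using root_exists by blast
  then show ?thesis
    unfolding qroot_def by (rule theI) (simp add: power_q_inject flip: \<open>y ^ q = a\<close>)
qed

lemma qroot_eq_iff: "qroot a = y \<longleftrightarrow> y ^ q = a"
  using qroot_power[of a] power_q_inject by auto

lemma qroot_add: "qroot (a + b) = qroot a + qroot b"
  by (simp add: qroot_eq_iff frobenius_add qroot_power)

lemma vabs_qroot_power: "vabs (qroot a) ^ q = vabs a"
  by (simp add: qroot_power flip: vabs_power)

text \<open>An additive continuous map commutes with infinite sums; this is what lets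
  \<open>carlitz_d\<close> act term by term.\<close>

lemma has_sum_qroot:
  assumes "(f has_sum S) A"
  shows "((\<lambda>k. qroot (f k)) has_sum qroot S) A"
proof -
  have "Modules.additive qroot" by standard (rule qroot_add)
  moreover have "qroot \<midarrow>S\<rightarrow> qroot S"
    unfolding tendsto_iff
  proof (intro allI impI)
    fix e :: real assume "e > 0"
    \<comment> \<open>By additivity, the q-th power of the left side is
      \<open>dist a S\<close>.\<close>
    have "dist (qroot a) (qroot S) < e" if "dist a S < e ^ q" for a
    proof -
      have "qroot a - qroot S = qroot (a - S)"
        using qroot_add[of "a - S" S] by simp
      then have "dist (qroot a) (qroot S) ^ q < e ^ q"
        using that by (simp add: dist_eq_vabs vabs_qroot_power)
      then show ?thesis using \<open>e > 0\<close> by (rule power_less_imp_less_base[OF _ less_imp_le])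
    qed
    then show "\<forall>\<^sub>F a in at S. dist (qroot a) (qroot S) < e"
      using zero_less_power[OF \<open>e > 0\<close>, of q] unfolding eventually_at by blast
  qed
  ultimately show ?thesis
    using has_sum_comm_additive[OF _ _ assms] by (simp add: o_def)
qed

section \<open>Powers of x, brackets and Carlitz factorials\<close>

lemma x_nonzero [simp]: "x \<noteq> 0"
  using vabs_x q_ge_2 by auto

lemma vabs_x_less_1: "vabs x < 1"
  using vabs_x q_ge_2 by simp

text \<open>Powers of \<open>x\<close> are the supply of nonzero test points arbitrarily close to
  0.\<close>

lemma obtain_vabs_x_power_less:
  assumes "r > 0"
  obtains N where "N > 0" "vabs x ^ N < r"
proof -
  obtain N where N: "vabs x ^ N < r"
    using real_arch_pow_inv[OF assms vabs_x_less_1] by blast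
  have "vabs x ^ Suc N \<le> vabs x ^ N"
    using vabs_x_less_1 by (intro power_decreasing) auto
  also note N
  finally show ?thesis using that[of "Suc N"] by blast
qed

lemma x_power_tendsto_0: "(\<lambda>n. x ^ n) \<longlonglongrightarrow> 0"
  using vabs_x_less_1 by (simp add: tendsto_iff_vabs vabs_power LIMSEQ_power_zero)

text \<open>Needed for the limit as z tends to 0 to be unique.\<close>

lemma at_0_neq_bot: "at (0 :: 'c) \<noteq> bot"
proof -
  have "\<exists>y\<in>UNIV. (y :: 'c) \<noteq> 0 \<and> dist y 0 < e" if e: "e > 0" for e
  proof -
    obtain N where "vabs x ^ N < e" using obtain_vabs_x_power_less[OF e] by blast
    then have "dist (x ^ N) 0 < e" by (simp add: vabs_power flip: vabs_def)
    then show ?thesis by (intro bexI[of _ "x ^ N"]) auto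
  qed
  then have "(0::'c) islimpt UNIV" by (simp add: islimpt_approachable)
  then show ?thesis by (simp add: trivial_limit_within)
qed

abbreviation br :: "nat \<Rightarrow> 'c" where "br n \<equiv> x ^ (q ^ n) - x"

text \<open>For \<open>n > 0\<close> the term \<open>x\<close> strictly dominates
  \<open>x ^ (q ^ n)\<close>, and a strictly dominant term determines the absolute value. For
  \<open>n = 0\<close> the bracket is 0.\<close>

lemma vabs_br_pos:
  assumes "n > 0"
  shows "vabs (br n) = vabs x"
proof (rule antisym)
  have "q ^ n > 1" using assms q_ge_2 by (intro one_less_power) auto
  then have less: "vabs (x ^ (q ^ n)) < vabs x"
    using power_strict_decreasing[of 1 "q ^ n" "vabs x"] vabs_x_less_1 by (simp add: vabs_power)
  then show "vabs (br n) \<le> vabs x" using vabs_diff_le[of "x ^ (q ^ n)" x] by simp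
  show "vabs x \<le> vabs (br n)"
    using less vabs_diff_le[of "x ^ (q ^ n)" "br n"] by (simp add: max_def split: if_splits)
qed

lemma br_tendsto: "br \<longlonglongrightarrow> - x"
proof -
  have "n \<le> q ^ n" for n
    using q_ge_2 less_exp[of n] power_mono[of 2 q n] by (simp add: order.trans less_imp_le)
  then have "filterlim (\<lambda>n. q ^ n) at_top sequentially"
    by (intro filterlim_at_top_mono[OF filterlim_ident]) auto
  then have "(\<lambda>n. x ^ (q ^ n)) \<longlonglongrightarrow> 0"
    using filterlim_compose[OF x_power_tendsto_0] by blast
  from tendsto_diff[OF this tendsto_const[of x]] show ?thesis by simp
qed

lemma carlitz_D_0 [simp]: "carlitz_D q x 0 = 1"
  by (simp add: carlitz_D_def)

text \<open>The reason why \<open>carlitz_d\<close> lowers \<open>m\<close>: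
  \<open>br (Suc m)\<close> cancels the factor produced by the difference operator in
  \<open>z\<close>, and what remains of the denominator is a q-th power.\<close>

lemma carlitz_D_Suc: "carlitz_D q x (Suc m) = br (Suc m) * carlitz_D q x m ^ q"
  unfolding carlitz_D_def prod.lessThan_Suc_shift
  by (simp add: bracket_def prod_power_distrib power_mult mult.commute[of q])

lemma vabs_carlitz_D: "vabs (carlitz_D q x m) = vabs x ^ (\<Sum>k<m. q ^ k)"
proof (induction m)
  case (Suc m)
  have "(\<Sum>k<Suc m. q ^ k) = 1 + (\<Sum>k<m. q ^ k) * q"
    by (simp add: sum.lessThan_Suc_shift sum_distrib_left mult.commute[of _ q] del: sum.lessThan_Suc)
  with Suc show ?case
    using vabs_br_pos[of "Suc m"]
    by (simp add: carlitz_D_Suc vabs_mult vabs_power power_add power_mult del: sum.lessThan_Suc)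
qed simp

lemma carlitz_D_nonzero [simp]: "carlitz_D q x m \<noteq> 0"
  using vabs_carlitz_D[of m] by (metis power_eq_0_iff vabs_eq_0_iff x_nonzero)

text \<open>The geometric sum of exponents stays below \<open>q ^ m\<close>, so dividing
  \<open>z ^ (q ^ m)\<close> by the factorial costs no more than replacing \<open>z\<close> by
  \<open>z / x\<close>.\<close>

lemma vabs_carlitz_D_ge: "vabs x ^ (q ^ m) \<le> vabs (carlitz_D q x m)"
proof -
  have "(\<Sum>k<m. q ^ k) \<le> q ^ m"
  proof (induction m)
    case (Suc m)
    then have "(\<Sum>k<Suc m. q ^ k) \<le> 2 * q ^ m" by simp
    also have "\<dots> \<le> q ^ Suc m" using q_ge_2 by simp
    finally show ?case .
  qed simp
  then show ?thesis
    unfolding vabs_carlitz_D using vabs_x_less_1 by (intro power_decreasing) auto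
qed

end

section \<open>Series of the class and their coefficients\<close>

text \<open>Take weights \<open>t ^ h j\<close> with \<open>h\<close> injective. Two distinct
  vectors get equal weighted sums only if \<open>t\<close> is a root of the nonzero polynomial
  \<open>p v w\<close>; finitely many pairs exclude finitely many \<open>t\<close>.\<close>

lemma exists_separating_weights:
  fixes F :: "('j::finite \<Rightarrow> nat) set"
  assumes "finite F"
  obtains e :: "'j \<Rightarrow> nat" where "inj_on (\<lambda>v. \<Sum>j\<in>UNIV. e j * v j) F"
proof -
  obtain h :: "'j \<Rightarrow> nat" where h: "inj h"
    using finite_imp_inj_to_nat_seg[OF finite[of "UNIV :: 'j set"]] by blast
  define p :: "('j \<Rightarrow> nat) \<Rightarrow> ('j \<Rightarrow> nat) \<Rightarrow> int poly" where
    "p v w = (\<Sum>j\<in>UNIV. Polynomial.monom (int (v j) - int (w j)) (h j))" for v w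
  have p_nonzero: "p v w \<noteq> 0" if "v \<noteq> w" for v w
  proof -
    obtain j where j: "v j \<noteq> w j" using \<open>v \<noteq> w\<close> by auto
    have "Polynomial.coeff (p v w) (h j) = (\<Sum>k\<in>UNIV. if k = j then int (v k) - int (w k) else 0)"
      unfolding p_def coeff_sum using h by (intro sum.cong) (auto simp: inj_eq)
    with j show ?thesis by auto
  qed
  define R where "R = (\<Union>(v, w)\<in>{(v, w) \<in> F \<times> F. v \<noteq> w}. {a. poly (p v w) a = 0})"
  have "finite R"
    unfolding R_def using assms p_nonzero
    by (intro finite_UN_I) (auto intro: finite_subset[of _ "F \<times> F"] poly_roots_finite)
  moreover have "infinite (range int)" by (simp add: finite_image_iff inj_on_def)
  ultimately obtain t where t: "int t \<notin> R"
    by (metis finite_subset image_subsetI)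
  have "inj_on (\<lambda>v. \<Sum>j\<in>UNIV. t ^ h j * v j) F"
  proof (rule inj_onI, rule ccontr)
    fix v w assume vw: "v \<in> F" "w \<in> F" "v \<noteq> w"
      and eq: "(\<Sum>j\<in>UNIV. t ^ h j * v j) = (\<Sum>j\<in>UNIV. t ^ h j * w j)"
    have "poly (p v w) (int t) = int (\<Sum>j\<in>UNIV. t ^ h j * v j) - int (\<Sum>j\<in>UNIV. t ^ h j * w j)"
      by (simp add: p_def poly_sum poly_monom sum_subtractf algebra_simps)
    with eq have "int t \<in> R" using vw by (auto simp: R_def)
    with t show False by blast
  qed
  then show ?thesis using that[of "\<lambda>j. t ^ h j"] by blast
qed

text \<open>\<open>S\<close> may be infinite, but only finitely many exponent vectors have the least
  total degree, and these can be separated.\<close>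

lemma exists_weights_unique_min:
  fixes v :: "'a \<Rightarrow> 'j::finite \<Rightarrow> nat"
  assumes "inj_on v S" "S \<noteq> {}"
  obtains e :: "'j \<Rightarrow> nat" and k0 where "\<And>j. e j > 0" "k0 \<in> S"
    "\<And>k. k \<in> S \<Longrightarrow> k \<noteq> k0 \<Longrightarrow> (\<Sum>j\<in>UNIV. e j * v k0 j) < (\<Sum>j\<in>UNIV. e j * v k j)"
proof -
  define deg where "deg k = (\<Sum>j\<in>UNIV. v k j)" for k
  obtain k1 where k1: "k1 \<in> S" "\<And>k. k \<in> S \<Longrightarrow> deg k1 \<le> deg k"
    using assms(2) ex_has_least_nat[of "\<lambda>k. k \<in> S" _ deg] by blast
  define d where "d = deg k1"
  define F where "F = v ` {k \<in> S. deg k = d}"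
  have "F \<subseteq> PiE UNIV (\<lambda>_. {..d})"
    by (auto simp: F_def deg_def intro!: member_le_sum)
  then have "finite F" by (rule finite_subset) (auto intro: finite_PiE)
  then obtain e where e: "inj_on (\<lambda>v. \<Sum>j\<in>UNIV. e j * v j) F"
    by (rule exists_separating_weights)
  define wt where "wt k = (\<Sum>j\<in>UNIV. e j * v k j)" for k
  \<comment> \<open>A large multiple of the total degree confines the minimum to \<open>F\<close>, where \<open>e\<close> breaks the ties.\<close>
  define L where "L = Suc (wt k1)"
  define E where "E k = (\<Sum>j\<in>UNIV. (L + e j) * v k j)" for k
  have E: "E k = L * deg k + wt k" for k
    by (simp add: E_def deg_def wt_def sum.distrib sum_distrib_left algebra_simps)
  obtain k0 where k0: "k0 \<in> S" "\<And>k. k \<in> S \<Longrightarrow> E k0 \<le> E k"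
    using assms(2) ex_has_least_nat[of "\<lambda>k. k \<in> S" _ E] by blast
  have deg_d: "deg k = d" if "k \<in> S" "E k = E k0" for k
  proof -
    have "L * deg k \<le> E k" by (simp add: E)
    also have "\<dots> \<le> E k1" using that k0 k1 by simp
    \<comment> \<open>Strict because \<open>wt k1 < L\<close>; this dictates the choice of
      \<open>L\<close>.\<close>
    also have "\<dots> < L * Suc d" by (simp add: E d_def L_def)
    finally have "deg k \<le> d" by (metis less_Suc_eq_le mult_less_cancel1)
    with k1(2)[OF that(1)] show ?thesis by (simp add: d_def)
  qed
  have "E k0 < E k" if "k \<in> S" "k \<noteq> k0" for k
  proof (rule ccontr)
    assume "\<not> E k0 < E k"
    with k0(2)[OF that(1)] have eq: "E k = E k0" by simp
    with deg_d[OF that(1)] deg_d[OF k0(1)] have deg: "deg k = d" "deg k0 = d" by simp_all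
    with eq have "wt k = wt k0" by (simp add: E)
    moreover have "v k \<in> F" "v k0 \<in> F" using that k0 deg by (auto simp: F_def)
    ultimately have "v k = v k0" using e by (auto simp: inj_on_def wt_def)
    with assms(1) that k0 show False by (auto simp: inj_on_def)
  qed
  then show ?thesis using that[of "\<lambda>j. L + e j" k0] k0(1) by (simp add: E_def L_def)
qed

context carlitz_setting
begin

text \<open>
  Restrict the series to a curve \<open>w j = t ^ e j\<close> on which a single nonzero term has the lowest order
  in \<open>t\<close>, and let \<open>t\<close> tend to zero.
\<close>
lemma power_series_eq_0_imp_coeff_eq_0:
  fixes b :: "'a \<Rightarrow> 'c" and v :: "'a \<Rightarrow> 'j::finite \<Rightarrow> nat"
  assumes inj: "inj_on v A" and "r > 0"
    and zero: "\<And>w. (\<And>j. vabs (w j) < r) \<Longrightarrow> ((\<lambda>k. b k * (\<Prod>j\<in>UNIV. w j ^ v k j)) has_sum 0) A"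
    and "k \<in> A"
  shows "b k = 0"
proof (rule ccontr)
  assume "b k \<noteq> 0"
  define S where "S = {k \<in> A. b k \<noteq> 0}"
  have "S \<noteq> {}" "inj_on v S"
    using \<open>b k \<noteq> 0\<close> \<open>k \<in> A\<close> inj by (auto simp: S_def inj_on_def)
  then obtain e k0 where e: "\<And>j. e j > 0" and k0: "k0 \<in> S"
    and min: "\<And>k. k \<in> S \<Longrightarrow> k \<noteq> k0 \<Longrightarrow> (\<Sum>j\<in>UNIV. e j * v k0 j) < (\<Sum>j\<in>UNIV. e j * v k j)"
    by (blast intro: exists_weights_unique_min)
  define E where "E k = (\<Sum>j\<in>UNIV. e j * v k j)" for k
  define \<rho> where "\<rho> = vabs x"
  have \<rho>: "0 < \<rho>" "\<rho> < 1" using vabs_x_less_1 by (auto simp: \<rho>_def)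
  obtain N where N: "\<rho> ^ N < r" using obtain_vabs_x_power_less[OF \<open>r > 0\<close>] by (auto simp: \<rho>_def)
  \<comment> \<open>The parameter of the curve is \<open>x ^ (N + l)\<close>: \<open>N\<close>
    places it inside the polydisc, and growing \<open>l\<close> moves it to 0.\<close>
  have curve: "((\<lambda>k. b k * (x ^ (N + l)) ^ E k) has_sum 0) A" for l
  proof -
    have "vabs ((x ^ (N + l)) ^ e j) < r" for j
    proof -
      have "\<rho> ^ ((N + l) * e j) \<le> \<rho> ^ N"
        using \<rho> e[of j] by (intro power_decreasing) (cases "e j"; simp)+
      with N show ?thesis by (simp add: vabs_power \<rho>_def flip: power_mult)
    qed
    then have "((\<lambda>k. b k * (\<Prod>j\<in>UNIV. ((x ^ (N + l)) ^ e j) ^ v k j)) has_sum 0) A"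
      by (rule zero)
    then show ?thesis by (simp add: E_def power_sum power_mult)
  qed
  then have "(\<lambda>k. b k * (x ^ (N + 0)) ^ E k) summable_on A"
    unfolding summable_on_def by blast
  then obtain B where B: "B \<ge> 1" "\<And>k. k \<in> A \<Longrightarrow> vabs (b k) * (\<rho> ^ N) ^ E k \<le> B"
    by (rule summable_on_imp_vabs_bounded) (auto simp: vabs_mult vabs_power \<rho>_def)
  define C where "C = vabs (b k0) * (\<rho> ^ N) ^ E k0"
  have "C > 0" using k0 \<rho> by (simp add: C_def S_def)
  \<comment> \<open>As the sum is 0, the term of \<open>k0\<close> is minus the sum of the others.
    Passing from 0 to \<open>l\<close> multiplies term \<open>k\<close> in absolute value by
    \<open>(\<rho> ^ l) ^ E k\<close>; since \<open>E k > E k0\<close>, the other terms carry a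
    surplus factor \<open>\<rho> ^ l\<close>.\<close>
  have le: "C \<le> B * \<rho> ^ l" for l
  proof -
    let ?f = "\<lambda>k. b k * (x ^ (N + l)) ^ E k"
    have f: "vabs (?f k) = vabs (b k) * (\<rho> ^ N) ^ E k * (\<rho> ^ l) ^ E k" for k
      by (simp add: vabs_mult vabs_power \<rho>_def power_add power_mult_distrib)
    have "(?f has_sum (0 - ?f k0)) (A - {k0})"
      using k0 by (intro has_sum_Diff curve has_sum_finiteI) (auto simp: S_def)
    then have "vabs (0 - ?f k0) \<le> B * (\<rho> ^ l) ^ Suc (E k0)"
    proof (rule vabs_has_sum_le)
      fix k assume k: "k \<in> A - {k0}"
      show "vabs (?f k) \<le> B * (\<rho> ^ l) ^ Suc (E k0)"
      proof (cases "b k = 0")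
        case False
        then have "E k0 < E k" using min[of k] k by (auto simp: S_def E_def)
        then have "(\<rho> ^ l) ^ E k \<le> (\<rho> ^ l) ^ Suc (E k0)"
          using \<rho> by (intro power_decreasing power_le_one) auto
        then show ?thesis unfolding f using B k \<rho> by (intro mult_mono) auto
      qed (use B \<rho> in auto)
    qed (use B \<rho> in auto)
    then have "C * (\<rho> ^ l) ^ E k0 \<le> B * \<rho> ^ l * (\<rho> ^ l) ^ E k0"
      using f[of k0] by (simp add: C_def mult_ac)
    then show ?thesis using \<rho> by simp
  qed
  obtain l where "\<rho> ^ l < C / B" using obtain_vabs_x_power_less[of "C / B"] B \<open>C > 0\<close>
    by (auto simp: \<rho>_def)
  with le[of l] B show False by (simp add: field_simps)
qed

definition carlitz_index :: "(nat \<times> ('n::finite \<Rightarrow> nat)) set" where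
  "carlitz_index = {(m, i). m \<le> Min (range i)}"

definition carlitz_term :: "(nat \<Rightarrow> ('n::finite \<Rightarrow> nat) \<Rightarrow> 'c) \<Rightarrow> 'c \<Rightarrow> 'c ^ 'n \<Rightarrow> nat \<times> ('n \<Rightarrow> nat) \<Rightarrow> 'c" where
  "carlitz_term c z s = (\<lambda>(m, i). c m i * s_monom q i s * (z ^ (q ^ m) / carlitz_D q x m))"

text \<open>Values of \<open>c\<close> outside \<open>carlitz_index\<close> are arbitrary, so
  coefficients are only ever compared on that set.\<close>

definition carlitz_series :: "('c \<times> ('c ^ 'n::finite) \<Rightarrow> 'c) \<Rightarrow> (nat \<Rightarrow> ('n \<Rightarrow> nat) \<Rightarrow> 'c) \<Rightarrow> bool" where
  "carlitz_series u c \<longleftrightarrow>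
     (\<forall>\<^sub>F (z, s) in nhds 0. (carlitz_term c z s has_sum u (z, s)) carlitz_index)"

lemma carlitz_index_iff: "(m, i) \<in> carlitz_index \<longleftrightarrow> (\<forall>j. m \<le> i j)"
  by (auto simp: carlitz_index_def)

text \<open>All entries of \<open>i\<close> are positive here, so the truncated subtraction is a
  true inverse of the shift.\<close>

lemma carlitz_index_SucE:
  assumes "(Suc m, i) \<in> carlitz_index"
  obtains i' where "i = (\<lambda>j. Suc (i' j))" "(m, i') \<in> carlitz_index"
proof (rule that[of "\<lambda>j. i j - 1"])
  have Suc_le: "Suc m \<le> i j" for j using assms by (simp add: carlitz_index_iff)
  show "i = (\<lambda>j. Suc (i j - 1))"
  proof
    show "i j = Suc (i j - 1)" for j using Suc_le[of j] by simp
  qed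
  show "(m, \<lambda>j. i j - 1) \<in> carlitz_index"
    unfolding carlitz_index_iff
  proof
    show "m \<le> i j - 1" for j using Suc_le[of j] by simp
  qed
qed

lemma carlitz_series_iff:
  "carlitz_series u c \<longleftrightarrow> (\<exists>r>0. \<forall>z s. vabs z < r \<and> (\<forall>j. vabs (s $ j) < r) \<longrightarrow>
     (carlitz_term c z s has_sum u (z, s)) carlitz_index)"
  unfolding carlitz_series_def eventually_nhds_zero_pair by simp

lemma carlitz_F_eq: "carlitz_F q x = germ ` {u. \<exists>c. carlitz_series u c}"
  unfolding carlitz_F_def carlitz_series_def carlitz_term_def carlitz_index_def ..

lemma carlitz_series_germ:
  assumes "carlitz_series u c" "v \<in> germ u"
  shows "carlitz_series v c"
proof -
  have "\<forall>\<^sub>F w in nhds 0. v w = u w" using assms(2) by (simp add: germ_def)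
  with assms(1) show ?thesis unfolding carlitz_series_def
    by eventually_elim auto
qed

lemma carlitz_series_cong:
  assumes "\<And>m i. (m, i) \<in> carlitz_index \<Longrightarrow> c m i = c' m i"
  shows "carlitz_series u c \<longleftrightarrow> carlitz_series u c'"
proof -
  have "(carlitz_term c z s has_sum a) carlitz_index \<longleftrightarrow>
      (carlitz_term c' z s has_sum a) carlitz_index" for z s a
    using assms by (intro has_sum_cong) (auto simp: carlitz_term_def)
  then show ?thesis by (simp add: carlitz_series_def)
qed

lemma carlitz_series_unique_function:
  assumes "carlitz_series u c" "carlitz_series v c"
  shows "\<forall>\<^sub>F w in nhds 0. u w = v w"
  using assms unfolding carlitz_series_def
  by eventually_elim (auto dest: has_sum_unique)

text \<open>Treat \<open>z\<close> as one more variable, indexed by \<open>None\<close>. Distinct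
  indices give distinct exponent vectors because \<open>q \<ge> 2\<close>, so the identity theorem
  applies.\<close>

lemma carlitz_series_eq_0_imp_coeff_eq_0:
  assumes "carlitz_series u c" "\<forall>\<^sub>F w in nhds 0. u w = 0" "(m, i) \<in> carlitz_index"
  shows "c m i = 0"
proof -
  have "\<forall>\<^sub>F (z, s) in nhds 0. (carlitz_term c z s has_sum 0) carlitz_index"
    using assms(1,2) unfolding carlitz_series_def by eventually_elim auto
  then obtain r where r: "r > 0"
    "\<And>z s. vabs z < r \<Longrightarrow> \<forall>j. vabs (s $ j) < r \<Longrightarrow> (carlitz_term c z s has_sum 0) carlitz_index"
    unfolding eventually_nhds_zero_pair by auto
  define v :: "nat \<times> ('a \<Rightarrow> nat) \<Rightarrow> 'a option \<Rightarrow> nat" where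
    "v = (\<lambda>(m, i) j. case j of None \<Rightarrow> q ^ m | Some j \<Rightarrow> q ^ i j)"
  define b where "b = (\<lambda>(m, i). c m i / carlitz_D q x m)"
  have "inj v"
  proof (rule injI)
    fix k l assume eq: "v k = v l"
    obtain m i m' i' where kl: "k = (m, i)" "l = (m', i')" by (cases k, cases l) auto
    have "q ^ m = q ^ m'" using fun_cong[OF eq, of None] by (simp add: v_def kl)
    moreover have "q ^ i j = q ^ i' j" for j
      using fun_cong[OF eq, of "Some j"] by (simp add: v_def kl)
    ultimately show "k = l" using q_ge_2 by (auto simp: kl power_inject_exp')
  qed
  have "((\<lambda>k. b k * (\<Prod>j\<in>UNIV. w j ^ v k j)) has_sum 0) carlitz_index"
    if "\<And>j. vabs (w j) < r" for w :: "'a option \<Rightarrow> 'c"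
  proof -
    have "(carlitz_term c (w None) (\<chi> j. w (Some j)) has_sum 0) carlitz_index"
      using that by (intro r) auto
    also have "carlitz_term c (w None) (\<chi> j. w (Some j)) = (\<lambda>k. b k * (\<Prod>j\<in>UNIV. w j ^ v k j))"
      by (auto simp: fun_eq_iff carlitz_term_def s_monom_def b_def v_def UNIV_option_conv
          prod.reindex mult_ac)
    finally show ?thesis .
  qed
  then have "b (m, i) = 0"
    using power_series_eq_0_imp_coeff_eq_0[of v carlitz_index r b "(m, i)"] \<open>inj v\<close> r(1) assms(3)
    by (auto intro: inj_on_subset)
  then show ?thesis by (simp add: b_def)
qed

section \<open>Action of the operators on coefficients\<close>

lemma carlitz_series_add:
  assumes "carlitz_series u c" "carlitz_series v d"
  shows "carlitz_series (\<lambda>w. u w + v w) (\<lambda>m i. c m i + d m i)"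
  using assms unfolding carlitz_series_def
proof eventually_elim
  case (elim w)
  have "carlitz_term (\<lambda>m i. c m i + d m i) z s = (\<lambda>k. carlitz_term c z s k + carlitz_term d z s k)" for z s
    by (auto simp: carlitz_term_def fun_eq_iff algebra_simps)
  with elim show ?case by (auto intro: has_sum_add)
qed

lemma carlitz_series_cmult:
  assumes "carlitz_series u c"
  shows "carlitz_series (\<lambda>w. a * u w) (\<lambda>m i. a * c m i)"
  using assms unfolding carlitz_series_def
proof eventually_elim
  case (elim w)
  have "carlitz_term (\<lambda>m i. a * c m i) z s = (\<lambda>k. a * carlitz_term c z s k)" for z s
    by (auto simp: carlitz_term_def fun_eq_iff algebra_simps)
  with elim show ?case by (auto intro: has_sum_cmult_right)
qed

lemma carlitz_series_0: "carlitz_series (\<lambda>_. 0) (\<lambda>_ _. 0)"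
  by (simp add: carlitz_series_def carlitz_term_def case_prod_unfold)

lemma carlitz_series_sum:
  assumes "finite A" "\<And>a. a \<in> A \<Longrightarrow> carlitz_series (u a) (c a)"
  shows "carlitz_series (\<lambda>w. \<Sum>a\<in>A. u a w) (\<lambda>m i. \<Sum>a\<in>A. c a m i)"
  using assms
  by (induction A rule: finite_induct) (auto intro: carlitz_series_add carlitz_series_0)

lemma carlitz_series_Delta:
  assumes "carlitz_series u c"
  shows "carlitz_series (carlitz_Delta x j u) (\<lambda>m i. br (i j) * c m i)"
proof -
  obtain r where r: "r > 0" "\<And>z s. vabs z < r \<Longrightarrow> \<forall>j. vabs (s $ j) < r \<Longrightarrow>
      (carlitz_term c z s has_sum u (z, s)) carlitz_index"
    using assms unfolding carlitz_series_iff by blast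
  have "(carlitz_term (\<lambda>m i. br (i j) * c m i) z s has_sum carlitz_Delta x j u (z, s)) carlitz_index"
    if small: "vabs z < r" "\<forall>j. vabs (s $ j) < r" for z s
  proof -
    define s' where "s' = (\<chi> k. if k = j then x * s $ k else s $ k)"
    have "vabs (s' $ k) \<le> vabs (s $ k)" for k
      using vabs_x_less_1 by (simp add: s'_def vabs_mult mult_left_le_one_le)
    then have "\<forall>k. vabs (s' $ k) < r" using small by (metis order_le_less_trans)
    then have "((\<lambda>k. carlitz_term c z s' k + - x * carlitz_term c z s k) has_sum
        u (z, s') + - x * u (z, s)) carlitz_index"
      using small by (intro has_sum_add has_sum_cmult_right r)
    moreover have "s_monom q i s' = x ^ (q ^ i j) * s_monom q i s" for i
    proof -
      have "s_monom q i s' = (\<Prod>k\<in>UNIV. (if k = j then x ^ (q ^ i k) else 1) * (s $ k) ^ (q ^ i k))"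
        unfolding s_monom_def by (intro prod.cong) (auto simp: s'_def power_mult_distrib)
      then show ?thesis by (simp add: prod.distrib s_monom_def)
    qed
    then have "(\<lambda>k. carlitz_term c z s' k + - x * carlitz_term c z s k) =
        carlitz_term (\<lambda>m i. br (i j) * c m i) z s"
      by (auto simp: fun_eq_iff carlitz_term_def algebra_simps)
    ultimately show ?thesis by (simp add: carlitz_Delta_def s'_def)
  qed
  with r(1) show ?thesis unfolding carlitz_series_iff by blast
qed

lemma carlitz_series_Delta_power:
  assumes "carlitz_series u c"
  shows "carlitz_series ((carlitz_Delta x j ^^ k) u) (\<lambda>m i. br (i j) ^ k * c m i)"
proof (induction k)
  case (Suc k)
  from carlitz_series_Delta[OF this, of j] show ?case by (simp add: mult.assoc)
qed (use assms in simp)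

text \<open>Commutation of the powers makes the fold unfoldable one index at a time, so the claim is
  proved for every finite set \<open>J\<close> of variables.\<close>

lemma carlitz_series_monom_op:
  assumes "carlitz_series u c"
  shows "carlitz_series (monom_op (carlitz_Delta x) d u)
    (\<lambda>m i. (\<Prod>j\<in>UNIV. br (i j) ^ Poly_Mapping.lookup d j) * c m i)"
proof -
  let ?g = "\<lambda>j S. (carlitz_Delta x j ^^ Poly_Mapping.lookup d j) \<circ> S"
  have comm1: "carlitz_Delta x j ((carlitz_Delta x k ^^ b) v) = (carlitz_Delta x k ^^ b) (carlitz_Delta x j v)"
    for j k b and v :: "'c \<times> ('c ^ 'a) \<Rightarrow> 'c"
    by (induction b) (simp_all add: carlitz_Delta_commute[of x j k])
  have comm: "(carlitz_Delta x j ^^ a) ((carlitz_Delta x k ^^ b) v) =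
      (carlitz_Delta x k ^^ b) ((carlitz_Delta x j ^^ a) v)"
    for j k a b and v :: "'c \<times> ('c ^ 'a) \<Rightarrow> 'c"
    by (induction a) (simp_all add: comm1)
  interpret comp_fun_commute ?g
    by unfold_locales (simp add: fun_eq_iff comm)
  have "carlitz_series (Finite_Set.fold ?g id J u)
      (\<lambda>m i. (\<Prod>j\<in>J. br (i j) ^ Poly_Mapping.lookup d j) * c m i)" if "finite J" for J
    using that
  proof (induction J rule: finite_induct)
    case (insert j J)
    have "Finite_Set.fold ?g id (insert j J) = ?g j (Finite_Set.fold ?g id J)"
      using insert.hyps by (rule fold_insert)
    then have fold_eq: "Finite_Set.fold ?g id (insert j J) u =
        (carlitz_Delta x j ^^ Poly_Mapping.lookup d j) (Finite_Set.fold ?g id J u)"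
      by (rule fun_cong[THEN trans]) (rule o_apply)
    show ?case
      unfolding fold_eq prod.insert[OF insert.hyps] mult.assoc
      by (rule carlitz_series_Delta_power[OF insert.IH])
  qed (use assms in simp)
  then show ?thesis unfolding monom_op_def by simp
qed

lemma carlitz_series_mpoly_op:
  assumes "carlitz_series u c"
  shows "carlitz_series (mpoly_op P (carlitz_Delta x) u)
    (\<lambda>m i. mpoly_eval P (\<lambda>j. br (i j)) * c m i)"
proof -
  have "carlitz_series (mpoly_op P (carlitz_Delta x) u)
    (\<lambda>m i. \<Sum>d\<in>Poly_Mapping.keys P. Poly_Mapping.lookup P d *
       ((\<Prod>j\<in>UNIV. br (i j) ^ Poly_Mapping.lookup d j) * c m i))"
    unfolding mpoly_op_def using assms
    by (intro carlitz_series_sum carlitz_series_cmult carlitz_series_monom_op) auto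
  then show ?thesis by (simp add: mpoly_eval_def sum_distrib_right mult.assoc)
qed

lemma carlitz_series_d:
  assumes "carlitz_series u c"
  shows "carlitz_series (carlitz_d q x u) (\<lambda>m i. qroot (c (Suc m) (\<lambda>j. Suc (i j))))"
proof -
  obtain r where r: "r > 0" "\<And>z s. vabs z < r \<Longrightarrow> \<forall>j. vabs (s $ j) < r \<Longrightarrow>
      (carlitz_term c z s has_sum u (z, s)) carlitz_index"
    using assms unfolding carlitz_series_iff by blast
  let ?c = "\<lambda>m i. qroot (c (Suc m) (\<lambda>j. Suc (i j)))"
  have "(carlitz_term ?c z s has_sum carlitz_d q x u (z, s)) carlitz_index"
    if small: "vabs z < r" "\<forall>j. vabs (s $ j) < r" for z s
  proof -
    have "vabs (x * z) \<le> vabs z"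
      using vabs_x_less_1 by (simp add: vabs_mult mult_left_le_one_le)
    then have small': "vabs (x * z) < r" using small by simp
    define g where "g = (\<lambda>k. carlitz_term c (x * z) s k + - x * carlitz_term c z s k)"
    define sh :: "nat \<times> ('a \<Rightarrow> nat) \<Rightarrow> nat \<times> ('a \<Rightarrow> nat)" where
      "sh = (\<lambda>(m, i). (Suc m, \<lambda>j. Suc (i j)))"
    have g: "g (m, i) = br m * carlitz_term c z s (m, i)" for m i
      by (simp add: g_def carlitz_term_def algebra_simps power_mult_distrib diff_divide_distrib)
    have "inj sh" by (auto simp: inj_def sh_def fun_eq_iff)
    have "(g has_sum (u (x * z, s) + - x * u (z, s))) carlitz_index"
      unfolding g_def using small small' by (intro has_sum_add has_sum_cmult_right r)
    \<comment> \<open>The terms left out are those with \<open>m = 0\<close>, which vanish because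
      \<open>br 0 = 0\<close>; by the constraint on \<open>m\<close>, all others are shifts.\<close>
    also have "?this \<longleftrightarrow> (g has_sum (u (x * z, s) + - x * u (z, s))) (sh ` carlitz_index)"
    proof (rule has_sum_cong_neutral)
      fix k assume "k \<in> carlitz_index - sh ` carlitz_index"
      moreover obtain m i where k: "k = (m, i)" by (cases k)
      moreover have "(m, i) \<in> sh ` carlitz_index" if "m = Suc m'" "(m, i) \<in> carlitz_index" for m'
        using that by (auto elim!: carlitz_index_SucE simp: sh_def intro!: rev_image_eqI)
      ultimately have "m = 0" by (cases m) auto
      then show "g k = 0" by (simp add: k g)
    qed (auto simp: sh_def carlitz_index_iff)
    also have "\<dots> \<longleftrightarrow> ((g \<circ> sh) has_sum (u (x * z, s) + - x * u (z, s))) carlitz_index"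
      using \<open>inj sh\<close> by (intro has_sum_reindex) (auto intro: inj_on_subset)
    finally have "((\<lambda>k. qroot ((g \<circ> sh) k)) has_sum qroot (u (x * z, s) + - x * u (z, s))) carlitz_index"
      by (rule has_sum_qroot)
    moreover have "qroot ((g \<circ> sh) k) = carlitz_term ?c z s k" for k
    proof (cases k)
      case (Pair m i)
      have "s_monom q (\<lambda>j. Suc (i j)) s = s_monom q i s ^ q"
        by (simp add: s_monom_def prod_power_distrib power_mult mult.commute[of q])
      moreover have "br (Suc m) \<noteq> 0" using carlitz_D_nonzero[of "Suc m"] carlitz_D_Suc[of m] by auto
      \<comment> \<open>Since q-th roots are unique, it suffices to compare q-th powers;
        \<open>carlitz_D_Suc\<close> cancels \<open>br (Suc m)\<close>.\<close>
      ultimately have "carlitz_term ?c z s k ^ q = (g \<circ> sh) k"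
        unfolding Pair sh_def o_def prod.case g carlitz_term_def carlitz_D_Suc
        by (simp add: power_mult_distrib power_divide qroot_power mult.commute[of q] flip: power_mult)
      then show ?thesis by (simp add: qroot_eq_iff)
    qed
    ultimately show ?thesis by (simp add: carlitz_d_def qroot_def)
  qed
  with r(1) show ?thesis unfolding carlitz_series_iff by blast
qed

end

section \<open>The equation and the initial condition in terms of coefficients\<close>

context carlitz_setting
begin

text \<open>The left side of the equation is again a series of the class, so it vanishes near 0
  exactly when its coefficients do.\<close>

lemma carlitz_series_equation_iff:
  assumes series: "carlitz_series u c"
  shows "(\<forall>\<^sub>F w in nhds 0. mpoly_op P (carlitz_Delta x) u w
        + mpoly_op Q (carlitz_Delta x) (carlitz_d q x u) w = 0) \<longleftrightarrow>
    (\<forall>m i. (m, i) \<in> carlitz_index \<longrightarrow> mpoly_eval P (\<lambda>j. br (i j)) * c m i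
        + mpoly_eval Q (\<lambda>j. br (i j)) * qroot (c (Suc m) (\<lambda>j. Suc (i j))) = 0)"
    (is "(\<forall>\<^sub>F w in _. ?u w = 0) \<longleftrightarrow> (\<forall>m i. _ \<longrightarrow> ?c m i = 0)")
proof -
  have series': "carlitz_series ?u ?c"
    by (intro carlitz_series_add carlitz_series_mpoly_op carlitz_series_d series)
  show ?thesis
  proof
    assume "\<forall>m i. (m, i) \<in> carlitz_index \<longrightarrow> ?c m i = 0"
    with series' have "carlitz_series ?u (\<lambda>_ _. 0)"
      using carlitz_series_cong[of ?c "\<lambda>_ _. 0" ?u] by blast
    then show "\<forall>\<^sub>F w in nhds 0. ?u w = 0"
      using carlitz_series_unique_function[OF _ carlitz_series_0] by blast
  qed (use carlitz_series_eq_0_imp_coeff_eq_0[OF series'] in blast)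
qed

text \<open>The terms with \<open>m = 0\<close> sum to \<open>z * l\<close>. All others have degree
  \<open>q ^ m \<ge> 2\<close> in \<open>z\<close>, and comparison with a fixed point
  \<open>z0\<close> bounds their sum by a multiple of |z|^2.\<close>

lemma carlitz_series_limit:
  fixes u :: "'c \<times> ('c ^ 'n::finite) \<Rightarrow> 'c"
  assumes "carlitz_series u c"
  shows "\<forall>\<^sub>F s in nhds 0. \<exists>l. ((\<lambda>i. c 0 i * s_monom q i s) has_sum l) UNIV \<and>
    ((\<lambda>z. inverse z * u (z, s)) \<longlongrightarrow> l) (at 0)"
proof -
  obtain r where r: "r > 0" "\<And>z s. vabs z < r \<Longrightarrow> \<forall>j. vabs (s $ j) < r \<Longrightarrow>
      (carlitz_term c z s has_sum u (z, s)) carlitz_index"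
    using assms unfolding carlitz_series_iff by blast
  obtain N where "vabs x ^ N < r" using obtain_vabs_x_power_less[OF r(1)] by blast
  define z0 where "z0 = x ^ N"
  have z0: "z0 \<noteq> 0" "vabs z0 < r" using \<open>vabs x ^ N < r\<close> by (auto simp: z0_def vabs_power)
  define I0 :: "(nat \<times> ('n \<Rightarrow> nat)) set" where "I0 = range (Pair 0)"
  have I0: "I0 \<subseteq> carlitz_index" by (auto simp: I0_def carlitz_index_iff)
  have term0: "carlitz_term c z s \<circ> Pair 0 = (\<lambda>i. z * (c 0 i * s_monom q i s))" for z s
    by (auto simp: carlitz_term_def)
  have "\<exists>l. ((\<lambda>i. c 0 i * s_monom q i s) has_sum l) UNIV \<and>
      ((\<lambda>z. inverse z * u (z, s)) \<longlongrightarrow> l) (at 0)" if s: "\<forall>j. vabs (s $ j) < r" for s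
  proof -
    have summable: "carlitz_term c z0 s summable_on carlitz_index"
      using r(2)[OF z0(2) s] by (auto simp: summable_on_def)
    then obtain B where B: "B \<ge> 1" "\<And>k. k \<in> carlitz_index \<Longrightarrow> vabs (carlitz_term c z0 s k) \<le> B"
      by (rule summable_on_imp_vabs_bounded) blast
    have "carlitz_term c z0 s summable_on I0"
      unfolding summable_on_iff_ultrametric
    proof (intro allI impI)
      fix e :: real assume "e > 0"
      then have "finite {k \<in> carlitz_index. e \<le> vabs (carlitz_term c z0 s k)}"
        using summable unfolding summable_on_iff_ultrametric by blast
      then show "finite {k \<in> I0. e \<le> vabs (carlitz_term c z0 s k)}"
        by (rule rev_finite_subset) (use I0 in auto)
    qed
    then have "(carlitz_term c z0 s \<circ> Pair 0) summable_on UNIV"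
      unfolding I0_def by (subst (asm) summable_on_reindex) (auto simp: inj_on_def)
    then obtain a where "((\<lambda>i. z0 * (c 0 i * s_monom q i s)) has_sum a) UNIV"
      unfolding term0 summable_on_def by blast
    from has_sum_cmult_right[OF this, of "inverse z0"] z0(1) obtain l where
      l: "((\<lambda>i. c 0 i * s_monom q i s) has_sum l) UNIV"
      by (auto simp flip: mult.assoc)
    have bound: "vabs (inverse z * u (z, s) - l) \<le> B / vabs z0 ^ 2 * vabs z"
      if z: "z \<noteq> 0" "vabs z < vabs z0" for z
    proof -
      have "((carlitz_term c z s \<circ> Pair 0) has_sum (z * l)) UNIV"
        unfolding term0 by (rule has_sum_cmult_right[OF l])
      then have "(carlitz_term c z s has_sum (z * l)) I0"
        unfolding I0_def by (subst has_sum_reindex) (auto simp: inj_on_def)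
      moreover have "(carlitz_term c z s has_sum u (z, s)) carlitz_index"
        using z z0 s by (intro r) auto
      ultimately have "(carlitz_term c z s has_sum (u (z, s) - z * l)) (carlitz_index - I0)"
        using I0 by (intro has_sum_Diff)
      then have "vabs (u (z, s) - z * l) \<le> B * (vabs z / vabs z0) ^ 2"
      proof (rule vabs_has_sum_le)
        fix k assume k: "k \<in> carlitz_index - I0"
        obtain m i where k_eq: "k = (m, i)" by (cases k)
        with k have "m > 0" by (cases m) (auto simp: I0_def)
        then have "q ^ 1 \<le> q ^ m" using q_ge_2 by (intro power_increasing) auto
        then have "2 \<le> q ^ m" using q_ge_2 by simp
        then have "(vabs z / vabs z0) ^ (q ^ m) \<le> (vabs z / vabs z0) ^ 2"
          using z by (intro power_decreasing) (auto simp: divide_simps)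
        moreover have "carlitz_term c z s k = carlitz_term c z0 s k * (z / z0) ^ (q ^ m)"
          using z0 by (simp add: k_eq carlitz_term_def power_divide)
        ultimately show "vabs (carlitz_term c z s k) \<le> B * (vabs z / vabs z0) ^ 2"
          using B(1) B(2)[of k] k by (auto simp: vabs_mult vabs_power vabs_divide intro!: mult_mono)
      qed (use B in auto)
      moreover have "inverse z * u (z, s) - l = inverse z * (u (z, s) - z * l)"
        using z by (simp add: algebra_simps)
      ultimately have "vabs (inverse z * u (z, s) - l) \<le> inverse (vabs z) * (B * (vabs z / vabs z0) ^ 2)"
        by (simp add: vabs_mult vabs_inverse mult_left_mono)
      also have "\<dots> = B / vabs z0 ^ 2 * vabs z"
        using z by (simp add: field_simps power2_eq_square)
      finally show ?thesis .
    qed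
    have "((\<lambda>z. inverse z * u (z, s)) \<longlongrightarrow> l) (at 0)"
      unfolding tendsto_iff_vabs
    proof (rule tendsto_sandwich)
      show "\<forall>\<^sub>F z in at 0. 0 \<le> vabs (inverse z * u (z, s) - l)" by simp
      show "\<forall>\<^sub>F z in at 0. vabs (inverse z * u (z, s) - l) \<le> B / vabs z0 ^ 2 * vabs z"
        using z0(1) bound unfolding eventually_at
        by (intro exI[of _ "vabs z0"]) (auto simp flip: vabs_def)
      have "((\<lambda>z::'c. vabs z) \<longlongrightarrow> vabs (0::'c)) (at 0)"
        unfolding vabs_def by (intro tendsto_dist tendsto_const tendsto_ident_at)
      then show "((\<lambda>z::'c. B / vabs z0 ^ 2 * vabs z) \<longlongrightarrow> 0) (at 0)"
        unfolding vabs_zero by (rule tendsto_mult_right_zero)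
    qed simp
    with l show ?thesis by blast
  qed
  with r(1) show ?thesis unfolding eventually_nhds_zero_vec by blast
qed

text \<open>Uniqueness of the limit makes the two series in \<open>s\<close> agree near 0; the
  identity theorem then compares coefficients.\<close>

lemma carlitz_series_initial_iff:
  fixes u :: "'c \<times> ('c ^ 'n::finite) \<Rightarrow> 'c"
  assumes series: "carlitz_series u c"
    and u0: "\<forall>\<^sub>F s in nhds 0. ((\<lambda>i. c0 i * s_monom q i s) has_sum u0 s) UNIV"
  shows "(\<forall>\<^sub>F s in nhds 0. ((\<lambda>z. inverse z * u (z, s)) \<longlongrightarrow> u0 s) (at 0)) \<longleftrightarrow> (\<forall>i. c 0 i = c0 i)"
proof
  assume "\<forall>i. c 0 i = c0 i"
  then have c0: "c 0 = c0" by auto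
  show "\<forall>\<^sub>F s in nhds 0. ((\<lambda>z. inverse z * u (z, s)) \<longlongrightarrow> u0 s) (at 0)"
    using carlitz_series_limit[OF series] u0
    by eventually_elim (auto simp: c0 dest: has_sum_unique)
next
  assume "\<forall>\<^sub>F s in nhds 0. ((\<lambda>z. inverse z * u (z, s)) \<longlongrightarrow> u0 s) (at 0)"
  with carlitz_series_limit[OF series] u0
  have "\<forall>\<^sub>F s in nhds 0. ((\<lambda>i. (c 0 i - c0 i) * s_monom q i s) has_sum 0) UNIV"
  proof eventually_elim
    case (elim s)
    then obtain l where l: "((\<lambda>i. c 0 i * s_monom q i s) has_sum l) UNIV"
      "((\<lambda>z. inverse z * u (z, s)) \<longlongrightarrow> l) (at 0)" by blast
    have "l = u0 s" using tendsto_unique[OF at_0_neq_bot l(2) elim(3)] .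
    with has_sum_add[OF l(1) has_sum_cmult_right[OF elim(2), of "- 1"]] show ?case by (simp add: algebra_simps)
  qed
  then obtain r where r: "r > 0" "\<And>s :: 'c ^ 'n. \<forall>j. vabs (s $ j) < r \<Longrightarrow>
      ((\<lambda>i. (c 0 i - c0 i) * s_monom q i s) has_sum 0) UNIV"
    unfolding eventually_nhds_zero_vec by blast
  define v :: "('n \<Rightarrow> nat) \<Rightarrow> 'n \<Rightarrow> nat" where "v i j = q ^ i j" for i j
  have "inj v"
  proof (rule injI)
    fix i i' assume eq: "v i = v i'"
    have "q ^ i j = q ^ i' j" for j
      using fun_cong[OF eq, of j] by (simp add: v_def)
    then show "i = i'" using q_ge_2 by (auto simp: power_inject_exp')
  qed
  have "((\<lambda>i. (c 0 i - c0 i) * (\<Prod>j\<in>UNIV. w j ^ v i j)) has_sum 0) UNIV"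
    if "\<And>j. vabs (w j) < r" for w
    using r(2)[of "\<chi> j. w j"] that by (simp add: s_monom_def v_def)
  then have "c 0 i - c0 i = 0" for i
    by (rule power_series_eq_0_imp_coeff_eq_0[OF \<open>inj v\<close> r(1)]) auto
  then show "\<forall>i. c 0 i = c0 i" by simp
qed

section \<open>Bounds over the points [i]\<close>

lemma bracket_enat: "bracket q x (enat n) = br n"
  by (simp add: bracket_def)

lemma compact_bracket_values:
  "compact {f :: 'n::finite \<Rightarrow> 'c. \<forall>j. f j \<in> range (bracket q x)}"
proof -
  have "UNIV = insert \<infinity> (range enat)"
    by (metis UNIV_eq_I enat.exhaust insert_iff rangeI infinity_enat_def not_infinity_eq)
  then have "range (bracket q x) = bracket q x ` insert \<infinity> (range enat)" by simp
  also have "\<dots> = insert (- x) (range br)"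
    by (simp add: image_image bracket_def)
  finally show ?thesis
    using compact_insert_limit[OF br_tendsto] by (intro compact_Pi_UNIV) simp
qed

lemma mpoly_eval_bracket_bounded:
  fixes P :: "('n::finite, 'c) mpolynomial"
  obtains M where "\<And>i. vabs (mpoly_eval P (\<lambda>j. bracket q x (i j))) \<le> M"
proof -
  let ?K = "{f :: 'n \<Rightarrow> 'c. \<forall>j. f j \<in> range (bracket q x)}"
  have "continuous_on ?K (\<lambda>f. vabs (mpoly_eval P f))"
    unfolding vabs_def by (intro continuous_on_dist mpoly_eval_continuous continuous_on_const)
  moreover have "?K \<noteq> {}" by auto
  ultimately obtain f0 where "\<forall>f\<in>?K. vabs (mpoly_eval P f) \<le> vabs (mpoly_eval P f0)"
    using continuous_attains_sup[OF compact_bracket_values] by blast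
  then show ?thesis by (intro that[of "vabs (mpoly_eval P f0)"]) auto
qed

text \<open>The minimum may be attained at a point with infinite entries. Nonvanishing at finite
  \<open>i\<close> alone would let the values tend to 0, since [n] tends to [\<infinity>].\<close>

lemma mpoly_eval_bracket_bounded_away:
  fixes Q :: "('n::finite, 'c) mpolynomial"
  assumes nonzero: "\<And>i :: 'n \<Rightarrow> enat. mpoly_eval Q (\<lambda>j. bracket q x (i j)) \<noteq> 0"
  obtains \<mu> where "\<mu> > 0" "\<And>i. \<mu> \<le> vabs (mpoly_eval Q (\<lambda>j. bracket q x (i j)))"
proof -
  let ?K = "{f :: 'n \<Rightarrow> 'c. \<forall>j. f j \<in> range (bracket q x)}"
  have "continuous_on ?K (\<lambda>f. vabs (mpoly_eval Q f))"
    unfolding vabs_def by (intro continuous_on_dist mpoly_eval_continuous continuous_on_const)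
  moreover have "?K \<noteq> {}" by auto
  ultimately obtain f0 where f0: "f0 \<in> ?K" "\<forall>f\<in>?K. vabs (mpoly_eval Q f0) \<le> vabs (mpoly_eval Q f)"
    using continuous_attains_inf[OF compact_bracket_values] by blast
  have "\<forall>j. \<exists>i. f0 j = bracket q x i" using f0(1) by auto
  then obtain i where "f0 = (\<lambda>j. bracket q x (i j))" by metis
  with nonzero[of i] have "vabs (mpoly_eval Q f0) > 0" by simp
  then show ?thesis using f0(2) by (intro that[of "vabs (mpoly_eval Q f0)"]) auto
qed

end

section \<open>Convergence of the solution\<close>

context carlitz_setting
begin

text \<open>The recursion solved for the shifted index. At indices with
  \<open>Suc m \<le> Min (range i)\<close> the subtraction is exact.\<close>

primrec carlitz_coeff ::
    "(('n \<Rightarrow> nat) \<Rightarrow> 'c) \<Rightarrow> (('n \<Rightarrow> nat) \<Rightarrow> 'c) \<Rightarrow> nat \<Rightarrow> ('n \<Rightarrow> nat) \<Rightarrow> 'c" where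
  "carlitz_coeff R c0 0 i = c0 i"
| "carlitz_coeff R c0 (Suc m) i = (R (\<lambda>j. i j - 1) * carlitz_coeff R c0 m (\<lambda>j. i j - 1)) ^ q"

lemma carlitz_coeff_unique:
  assumes "\<And>i. c 0 i = c0 i"
    and "\<And>m i. (m, i) \<in> carlitz_index \<Longrightarrow> c (Suc m) (\<lambda>j. Suc (i j)) = (R i * c m i) ^ q"
    and "(m, i) \<in> carlitz_index"
  shows "c m i = carlitz_coeff R c0 m i"
  using assms(3)
proof (induction m arbitrary: i)
  case (Suc m)
  from Suc.prems obtain i' where i': "i = (\<lambda>j. Suc (i' j))" "(m, i') \<in> carlitz_index"
    by (rule carlitz_index_SucE)
  then show ?case using assms(2)[OF i'(2)] Suc.IH[OF i'(2)] by simp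
qed (use assms(1) in simp)

text \<open>The factor \<open>A\<^sup>2\<close> absorbs the constant: \<open>A\<^sup>2 A ^ q \<le> (A\<^sup>2) ^ q\<close> because \<open>q \<ge> 2\<close>.\<close>
lemma vabs_carlitz_coeff_le:
  fixes R c0 :: "('n::finite \<Rightarrow> nat) \<Rightarrow> 'c"
  assumes A: "A \<ge> 1" "\<And>i. vabs (R i) \<le> A"
    and B: "B \<ge> 0" and T: "T \<ge> 0" and c0: "\<And>i. vabs (c0 i) \<le> B * T ^ (\<Sum>j\<in>UNIV. q ^ i j)"
    and "(m, i) \<in> carlitz_index"
  shows "A\<^sup>2 * vabs (carlitz_coeff R c0 m i) \<le> (A\<^sup>2 * B) ^ (q ^ m) * T ^ (\<Sum>j\<in>UNIV. q ^ i j)"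
  using assms(6)
proof (induction m arbitrary: i)
  case 0
  show ?case using c0[of i] by (simp add: mult.assoc mult_left_mono)
next
  case (Suc m)
  from Suc.prems obtain i' where i: "i = (\<lambda>j. Suc (i' j))" and i': "(m, i') \<in> carlitz_index"
    by (rule carlitz_index_SucE)
  define a where "a = vabs (carlitz_coeff R c0 m i')"
  have "A\<^sup>2 * vabs (carlitz_coeff R c0 (Suc m) i) = A\<^sup>2 * vabs (R i') ^ q * a ^ q"
    by (simp add: a_def i vabs_power vabs_mult power_mult_distrib)
  also have "\<dots> \<le> A\<^sup>2 * A ^ q * a ^ q"
    using A by (intro mult_right_mono mult_left_mono power_mono) (auto simp: a_def)
  also have "A\<^sup>2 * A ^ q \<le> (A\<^sup>2) ^ q"
    unfolding power_add[symmetric] power_mult[symmetric]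
    using A q_ge_2 by (intro power_increasing) auto
  also have "(A\<^sup>2) ^ q * a ^ q = (A\<^sup>2 * a) ^ q" by (simp add: power_mult_distrib)
  also have "\<dots> \<le> ((A\<^sup>2 * B) ^ (q ^ m) * T ^ (\<Sum>j\<in>UNIV. q ^ i' j)) ^ q"
    using Suc.IH[OF i'] A by (intro power_mono) (auto simp: a_def)
  \<comment> \<open>Multiplying the exponent of \<open>T\<close> by \<open>q\<close> is the same as
    shifting every entry of \<open>i'\<close>.\<close>
  also have "\<dots> = (A\<^sup>2 * B) ^ (q ^ Suc m) * T ^ (\<Sum>j\<in>UNIV. q ^ i j)"
    by (simp add: i power_mult_distrib sum_distrib_left mult_ac flip: power_mult)
  finally show ?case by (simp add: a_def mult_right_mono)
qed

text \<open>The exponent exceeds every \<open>i j\<close>, and \<open>m \<le> i j\<close>, so only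
  finitely many indices keep it below a given bound: the majorant tends to 0.\<close>

lemma summable_on_if_vabs_le_x_power:
  fixes f :: "nat \<times> ('n::finite \<Rightarrow> nat) \<Rightarrow> 'c"
  assumes "\<And>m i. (m, i) \<in> carlitz_index \<Longrightarrow> vabs (f (m, i)) \<le> vabs x ^ (\<Sum>j\<in>UNIV. q ^ i j)"
  shows "f summable_on carlitz_index"
  unfolding summable_on_iff_ultrametric
proof (intro allI impI)
  fix e :: real assume "e > 0"
  then obtain M where M: "vabs x ^ M < e" using obtain_vabs_x_power_less by blast
  have "{k \<in> carlitz_index. e \<le> vabs (f k)} \<subseteq> {..M} \<times> PiE UNIV (\<lambda>_. {..M})"
  proof (rule subsetI)
    fix k assume k: "k \<in> {k \<in> carlitz_index. e \<le> vabs (f k)}"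
    obtain m i where k_eq: "k = (m, i)" by (cases k)
    have "i j \<le> M" for j
    proof (rule ccontr)
      assume "\<not> i j \<le> M"
      have "i j < 2 ^ i j" by (rule less_exp)
      also have "2 ^ i j \<le> q ^ i j" using q_ge_2 by (intro power_mono) auto
      also have "\<dots> \<le> (\<Sum>j\<in>UNIV. q ^ i j)" by (intro member_le_sum) auto
      finally have "vabs x ^ (\<Sum>j\<in>UNIV. q ^ i j) \<le> vabs x ^ M"
        using \<open>\<not> i j \<le> M\<close> vabs_x_less_1 by (intro power_decreasing) auto
      with M assms[of m i] k show False by (simp add: k_eq)
    qed
    \<comment> \<open>Any entry of \<open>i\<close> bounds \<open>m\<close>;
      \<open>undefined\<close> merely names one.\<close>
    moreover from this[of undefined] have "m \<le> M"
      using k by (auto simp: k_eq carlitz_index_iff intro: le_trans)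
    ultimately show "k \<in> {..M} \<times> PiE UNIV (\<lambda>_. {..M})" by (auto simp: k_eq)
  qed
  then show "finite {k \<in> carlitz_index. e \<le> vabs (f k)}"
    by (rule finite_subset) (simp add: finite_PiE)
qed

lemma vabs_s_monom: "vabs (s_monom q i s) = (\<Prod>j\<in>UNIV. vabs (s $ j) ^ (q ^ i j))"
  by (simp add: s_monom_def vabs_prod vabs_power)

lemma carlitz_series_carlitz_coeff_exists:
  fixes R c0 :: "('n::finite \<Rightarrow> nat) \<Rightarrow> 'c"
  assumes R: "\<And>i. vabs (R i) \<le> A"
    and u0: "\<forall>\<^sub>F s in nhds 0. ((\<lambda>i. c0 i * s_monom q i s) has_sum u0 s) UNIV"
  shows "\<exists>u. carlitz_series u (carlitz_coeff R c0)"
proof -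
  define \<rho> where "\<rho> = vabs x"
  have \<rho>: "\<rho> > 0" by (simp add: \<rho>_def)
  obtain r where r: "r > 0" "\<And>s :: 'c ^ 'n. \<forall>j. vabs (s $ j) < r \<Longrightarrow>
      ((\<lambda>i. c0 i * s_monom q i s) has_sum u0 s) UNIV"
    using u0 unfolding eventually_nhds_zero_vec by blast
  obtain N where N: "\<rho> ^ N < r" using obtain_vabs_x_power_less[OF r(1)] by (auto simp: \<rho>_def)
  \<comment> \<open>Equal coordinates turn the Cauchy estimate at \<open>s0\<close> into a bound by
    a single power of \<open>T = 1 / \<rho> ^ N\<close>.\<close>
  define s0 :: "'c ^ 'n" where "s0 = (\<chi> j. x ^ N)"
  have "((\<lambda>i. c0 i * s_monom q i s0) has_sum u0 s0) UNIV"
    using N by (intro r) (simp add: s0_def vabs_power \<rho>_def)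
  then have "(\<lambda>i. c0 i * s_monom q i s0) summable_on UNIV" by (auto simp: summable_on_def)
  then obtain B where B: "B \<ge> 1" "\<And>i. vabs (c0 i * s_monom q i s0) \<le> B"
    by (rule summable_on_imp_vabs_bounded) blast
  define T where "T = 1 / \<rho> ^ N"
  have T: "T > 0" using \<rho> by (simp add: T_def)
  have c0: "vabs (c0 i) \<le> B * T ^ (\<Sum>j\<in>UNIV. q ^ i j)" for i
  proof -
    have "vabs (s_monom q i s0) = (\<rho> ^ N) ^ (\<Sum>j\<in>UNIV. q ^ i j)"
      by (simp add: vabs_s_monom s0_def vabs_power \<rho>_def power_sum)
    with B(2)[of i] \<rho> show ?thesis
      by (simp add: vabs_mult T_def power_divide field_simps)
  qed
  define A' where "A' = max 1 A"
  have A': "A' \<ge> 1" "\<And>i. vabs (R i) \<le> A'" using R by (auto simp: A'_def intro: le_max_iff_disj[THEN iffD2])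
  define C where "C = A'\<^sup>2 * B"
  have "C > 0" using A' B by (simp add: C_def)
  \<comment> \<open>|z| < \<rho>/C gives (C|z|/\<rho>)^(q^m) at most 1, where \<rho> pays for the
    factorial. |s_j| < \<rho>/T cancels the growth in \<open>T\<close> and leaves a power of \<rho>,
    which makes the terms tend to 0.\<close>
  define r' where "r' = min (\<rho> / C) (\<rho> / T)"
  have "r' > 0" using \<rho> T \<open>C > 0\<close> by (simp add: r'_def)
  have summable: "carlitz_term (carlitz_coeff R c0) z s summable_on carlitz_index"
    if z: "vabs z < r'" and s: "\<forall>j. vabs (s $ j) < r'" for z s
  proof (rule summable_on_if_vabs_le_x_power)
    fix m and i :: "'n \<Rightarrow> nat" assume mi: "(m, i) \<in> carlitz_index"
    let ?a = "carlitz_coeff R c0 m i" and ?S = "\<Sum>j\<in>UNIV. q ^ i j"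
    have "1 * vabs ?a \<le> A'\<^sup>2 * vabs ?a"
      using A'(1) by (intro mult_right_mono) (auto simp: one_le_power)
    also have "\<dots> \<le> C ^ (q ^ m) * T ^ ?S"
      unfolding C_def using A' B(1) T c0 mi by (intro vabs_carlitz_coeff_le) auto
    finally have a: "vabs ?a \<le> C ^ (q ^ m) * T ^ ?S" by simp
    have D: "vabs (z ^ (q ^ m) / carlitz_D q x m) \<le> (vabs z / \<rho>) ^ (q ^ m)"
      unfolding vabs_divide vabs_power power_divide
      using vabs_carlitz_D_ge[of m] \<rho> by (intro divide_left_mono) (auto simp: \<rho>_def)
    have "T ^ ?S * vabs (s_monom q i s) = (\<Prod>j\<in>UNIV. (T * vabs (s $ j)) ^ (q ^ i j))"
      by (simp add: vabs_s_monom power_sum power_mult_distrib prod.distrib)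
    also have "\<dots> \<le> (\<Prod>j\<in>UNIV. \<rho> ^ (q ^ i j))"
    proof (intro prod_mono conjI power_mono)
      fix j
      have "vabs (s $ j) < \<rho> / T" using s by (simp add: r'_def)
      then show "T * vabs (s $ j) \<le> \<rho>" using T by (simp add: field_simps)
    qed (use T in auto)
    finally have S: "T ^ ?S * vabs (s_monom q i s) \<le> \<rho> ^ ?S" by (simp add: power_sum)
    have "C * (vabs z / \<rho>) \<le> 1" using z \<rho> \<open>C > 0\<close> by (simp add: r'_def field_simps)
    then have Z: "(C * (vabs z / \<rho>)) ^ (q ^ m) \<le> 1"
      using \<rho> \<open>C > 0\<close> by (intro power_le_one) auto
    have "vabs (carlitz_term (carlitz_coeff R c0) z s (m, i))
        = vabs ?a * vabs (s_monom q i s) * vabs (z ^ (q ^ m) / carlitz_D q x m)"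
      by (simp only: carlitz_term_def prod.case vabs_mult)
    also have "\<dots> \<le> (C ^ (q ^ m) * T ^ ?S) * vabs (s_monom q i s) * (vabs z / \<rho>) ^ (q ^ m)"
      using a D T \<open>C > 0\<close> by (intro mult_mono) auto
    also have "\<dots> = (C * (vabs z / \<rho>)) ^ (q ^ m) * (T ^ ?S * vabs (s_monom q i s))"
      by (simp only: power_mult_distrib mult_ac)
    also have "\<dots> \<le> 1 * \<rho> ^ ?S"
      using Z S T \<rho> by (intro mult_mono) auto
    finally show "vabs (carlitz_term (carlitz_coeff R c0) z s (m, i)) \<le> vabs x ^ ?S"
      by (simp add: \<rho>_def)
  qed
  have "carlitz_series (\<lambda>(z, s). infsum (carlitz_term (carlitz_coeff R c0) z s) carlitz_index)
      (carlitz_coeff R c0)"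
    unfolding carlitz_series_iff using \<open>r' > 0\<close> summable by (intro exI[of _ r']) auto
  then show ?thesis by blast
qed

section \<open>Existence and uniqueness of the germ\<close>

lemma carlitz_cauchy_problem:
  fixes P Q :: "('n::finite, 'c) mpolynomial" and u0 :: "'c ^ 'n \<Rightarrow> 'c"
  assumes Q: "\<And>i :: 'n \<Rightarrow> enat. mpoly_eval Q (\<lambda>j. bracket q x (i j)) \<noteq> 0"
    and u0: "\<forall>\<^sub>F s in nhds 0. ((\<lambda>i. c0 i * s_monom q i s) has_sum u0 s) UNIV"
  shows "\<exists>!U. U \<in> carlitz_F q x \<and>
    (\<forall>u\<in>U.
      (\<forall>\<^sub>F w in nhds 0.
         mpoly_op P (carlitz_Delta x) u w + mpoly_op Q (carlitz_Delta x) (carlitz_d q x u) w = 0) \<and>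
      (\<forall>\<^sub>F s in nhds 0. ((\<lambda>z. inverse z * u (z, s)) \<longlongrightarrow> u0 s) (at 0)))"
proof -
  define R where "R i = - mpoly_eval P (\<lambda>j. br (i j)) / mpoly_eval Q (\<lambda>j. br (i j))" for i :: "'n \<Rightarrow> nat"
  have Q_br: "mpoly_eval Q (\<lambda>j. br (i j)) \<noteq> 0" for i :: "'n \<Rightarrow> nat"
    using Q[of "\<lambda>j. enat (i j)"] by (simp add: bracket_enat)
  obtain M where M: "\<And>i. vabs (mpoly_eval P (\<lambda>j. bracket q x (i j))) \<le> M"
    by (rule mpoly_eval_bracket_bounded) blast
  obtain \<mu> where \<mu>: "\<mu> > 0" "\<And>i. \<mu> \<le> vabs (mpoly_eval Q (\<lambda>j. bracket q x (i j)))"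
    by (rule mpoly_eval_bracket_bounded_away[OF Q]) blast
  have "vabs (R i) \<le> M / \<mu>" for i
    using M[of "\<lambda>j. enat (i j)"] \<mu>(1) \<mu>(2)[of "\<lambda>j. enat (i j)"]
    by (auto simp: R_def vabs_divide bracket_enat intro!: frac_le intro: order_trans[OF vabs_nonneg])
  then obtain u where u: "carlitz_series u (carlitz_coeff R c0)"
    using carlitz_series_carlitz_coeff_exists[OF _ u0] by blast
  have solution_iff: "(\<forall>\<^sub>F w in nhds 0.
        mpoly_op P (carlitz_Delta x) v w + mpoly_op Q (carlitz_Delta x) (carlitz_d q x v) w = 0) \<and>
      (\<forall>\<^sub>F s in nhds 0. ((\<lambda>z. inverse z * v (z, s)) \<longlongrightarrow> u0 s) (at 0)) \<longleftrightarrow>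
      (\<forall>m i. (m, i) \<in> carlitz_index \<longrightarrow> c (Suc m) (\<lambda>j. Suc (i j)) = (R i * c m i) ^ q) \<and>
      (\<forall>i. c 0 i = c0 i)" if "carlitz_series v c" for v c
  proof -
    have "mpoly_eval P (\<lambda>j. br (i j)) * c m i
        + mpoly_eval Q (\<lambda>j. br (i j)) * qroot (c (Suc m) (\<lambda>j. Suc (i j))) = 0 \<longleftrightarrow>
      c (Suc m) (\<lambda>j. Suc (i j)) = (R i * c m i) ^ q" for m and i :: "'n \<Rightarrow> nat"
    proof -
      have "mpoly_eval P (\<lambda>j. br (i j)) * c m i
        + mpoly_eval Q (\<lambda>j. br (i j)) * qroot (c (Suc m) (\<lambda>j. Suc (i j))) = 0 \<longleftrightarrow>
        qroot (c (Suc m) (\<lambda>j. Suc (i j))) = R i * c m i"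
        using Q_br[of i] by (auto simp: R_def field_simps eq_neg_iff_add_eq_0)
      then show ?thesis by (auto simp: qroot_eq_iff)
    qed
    with that show ?thesis
      by (simp add: carlitz_series_equation_iff carlitz_series_initial_iff[OF _ u0])
  qed
  show ?thesis
  proof (rule ex1I[of _ "germ u"])
    show "germ u \<in> carlitz_F q x \<and> (\<forall>v\<in>germ u.
      (\<forall>\<^sub>F w in nhds 0.
         mpoly_op P (carlitz_Delta x) v w + mpoly_op Q (carlitz_Delta x) (carlitz_d q x v) w = 0) \<and>
      (\<forall>\<^sub>F s in nhds 0. ((\<lambda>z. inverse z * v (z, s)) \<longlongrightarrow> u0 s) (at 0)))"
      \<comment> \<open>Every representative of the germ has the coefficients of \<open>u\<close>,
        so \<open>solution_iff\<close> settles all of them at once.\<close>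
      using u by (auto simp: carlitz_F_eq solution_iff[OF carlitz_series_germ[OF u]])
  next
    fix V assume V: "V \<in> carlitz_F q x \<and> (\<forall>v\<in>V.
      (\<forall>\<^sub>F w in nhds 0.
         mpoly_op P (carlitz_Delta x) v w + mpoly_op Q (carlitz_Delta x) (carlitz_d q x v) w = 0) \<and>
      (\<forall>\<^sub>F s in nhds 0. ((\<lambda>z. inverse z * v (z, s)) \<longlongrightarrow> u0 s) (at 0)))"
    then obtain v c where v: "V = germ v" "carlitz_series v c" by (auto simp: carlitz_F_eq)
    \<comment> \<open>The conditions are given for all representatives; testing \<open>v\<close>,
      whose coefficients are at hand, suffices.\<close>
    have "v \<in> V" by (simp add: v germ_def)
    with V solution_iff[OF v(2)] have "c m i = carlitz_coeff R c0 m i"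
      if "(m, i) \<in> carlitz_index" for m i
      using that by (intro carlitz_coeff_unique) auto
    with v(2) have "carlitz_series v (carlitz_coeff R c0)"
      using carlitz_series_cong by blast
    from carlitz_series_unique_function[OF this u] have eq: "\<forall>\<^sub>F w in nhds 0. v w = u w" .
    have "(\<forall>\<^sub>F w in nhds 0. f w = v w) \<longleftrightarrow> (\<forall>\<^sub>F w in nhds 0. f w = u w)" for f
      by (rule eventually_subst) (use eq in \<open>eventually_elim, simp\<close>)
    then show "V = germ u" by (simp add: v germ_def)
  qed
qed

end

theorem theorem1:
  fixes \<iota> :: "'k::{field,finite} fls alg_closure \<Rightarrow> 'c::complete_valued_field"
    and P Q :: "('n::finite, 'c) mpolynomial"
    and c0 :: "('n \<Rightarrow> nat) \<Rightarrow> 'c"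
    and u0 :: "'c ^ 'n \<Rightarrow> 'c"
    and q :: nat and x :: 'c
  assumes "completed_alg_closure \<iota>"
    and "q = CARD('k)"
    and "x = \<iota> (to_ac fls_X)"
    and "P \<noteq> 0" and "Q \<noteq> 0"
    and "\<forall>i :: 'n \<Rightarrow> enat. mpoly_eval Q (\<lambda>j. bracket q x (i j)) \<noteq> 0"
    and "\<forall>\<^sub>F s in nhds 0. ((\<lambda>i. c0 i * s_monom q i s) has_sum u0 s) UNIV"
  shows "\<exists>!U. U \<in> carlitz_F q x \<and>
    (\<forall>u\<in>U.
      (\<forall>\<^sub>F w in nhds 0.
         mpoly_op P (carlitz_Delta x) u w + mpoly_op Q (carlitz_Delta x) (carlitz_d q x u) w = 0) \<and>
      (\<forall>\<^sub>F s in nhds 0. ((\<lambda>z. inverse z * u (z, s)) \<longlongrightarrow> u0 s) (at 0)))"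
proof -
  interpret carlitz_setting q x
    using completed_alg_closure.carlitz_setting[OF assms(1)] assms(2,3) by simp
  show ?thesis using assms(6,7) by (intro carlitz_cauchy_problem) auto
qed

end
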